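(* Let $\kappa\ne0$ and suppose $(\bar p;V_0\oplus V_1\oplus\cdots\oplus V_k;a_1,\dots,a_k)$ are initial data for a warped product decomposition of $\mathbb{E}^n_\nu(\kappa)$. Let $\psi:N_0\times_{\rho_1}N_1\times\cdots\times_{\rho_k}N_k\to\mathbb{E}^n_\nu$ be the warped product decomposition of $\mathbb{E}^n_\nu$ with initial data $(\bar p;(\mathbb{R}\bar p\oplus V_0)\oplus V_1\oplus\cdots\oplus V_k;a_1,\dots,a_k)$, and let $\phi$ be the restriction of $\psi$ to $N_0(\kappa)\times_{\rho_1}N_1\times\cdots\times_{\rho_k}N_k$, where $N_0(\kappa):=\{p\in N_0:p^2=\kappa^{-1}\}$. Then $\phi$ is a warped product decomposition of $\mathbb{E}^n_\nu(\kappa)$ determined by $(\bar p;V_0\oplus V_1\oplus\cdots\oplus V_k;a_1,\dots,a_k)$.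
   Context: $\mathbb{E}^n_\nu$ denotes pseudo-Euclidean space: an $n$-dimensional real vector space with a non-degenerate symmetric bilinear form $\langle\cdot,\cdot\rangle$ having $\nu$ negative diagonal entries in a diagonalizing basis; $x^2:=\langle x,x\rangle$. Tangent vectors are identified with vectors of $\mathbb{E}^n_\nu$. For $\kappa\ne0$, $\mathbb{E}^n_\nu(\kappa):=\{p\in\mathbb{E}^n_\nu:\langle p,p\rangle=\kappa^{-1}\}$ with the induced metric. The warped product $M_0\times_{\rho_1}M_1\times\cdots\times_{\rho_k}M_k$ of pseudo-Riemannian manifolds $(M_i,g_i)$, with $\rho_i:M_0\to\mathbb{R}^+$, is the product manifold with metric $\pi_0^*g_0+\sum_{i\geq 1}\rho_i^2\pi_i^*g_i$. A warped product decomposition of $M$ is a warped product together with an isometry of it onto a non-empty open subset of $M$. The leaf $L_i(\cdot)$ is obtained by varying the $i$-th coordinate and fixing the others (transported by the isometry). Initial data for a warped product decomposition of $\mathbb{E}^n_\nu(\kappa)$, $\kappa\ne0$: a point $\bar p\in\mathbb{E}^n_\nu(\kappa)$, an orthogonal decomposition $T_{\bar p}\mathbb{E}^n_\nu(\kappa)=V_0\oplus\cdots\oplus V_k$ into non-trivial (hence non-degenerate) subspaces, $k\ge1$, and vectors $a_i=\kappa\bar p-z_i$ with $z_1,\dots,z_k\in V_0$ satisfying $\langle z_i,z_j\rangle=-\kappa$ for $i\ne j$ (equivalently the $a_i$ are pairwise orthogonal), such that $a_1,\dots,a_k$ are linearly independent. For initial data $(\bar p;U_0\oplus U_1\oplus\cdots\oplus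 U_k;a_1,\dots,a_k)$ in $\mathbb{E}^n_\nu$ ($\mathbb{E}^n_\nu=U_0\oplus\cdots\oplus U_k$ orthogonal, $a_i\in U_0$ pairwise orthogonal and linearly independent), the corresponding warped product decomposition is $\psi(p_0,\dots,p_k)=p_0+\sum_{i=1}^k\rho_i(p_0)(p_i-\bar p)$ on $N_0\times_{\rho_1}N_1\times\cdots\times_{\rho_k}N_k$, where $\rho_i(p_0)=1+\langle a_i,p_0-\bar p\rangle$, $N_0=\{p_0\in\bar p+U_0:\rho_i(p_0)>0\ \forall i\}$, and for $i\ge1$: if $\kappa_i:=a_i^2\ne0$, $N_i=(\bar p-\frac{a_i}{\kappa_i})+\{p\in\mathbb{R}a_i\oplus U_i:p^2=1/\kappa_i\}$; if $a_i$ is lightlike, $N_i=\bar p+\{p-\frac12p^2a_i:p\in U_i\}$. A warped product decomposition of $\mathbb{E}^n_\nu(\kappa)$ is determined by $(\bar p;V_0\oplus\cdots\oplus V_k;a_1,\dots,a_k)$ if $\bar p$ lies in its image, $T_{\bar p}L_i(\bar p)=V_i$ for $i=0,\dots,k$, and for $i\ge1$ the leaf $L_i(\bar p)$ has mean curvature vector $z_i=\kappa\bar p-a_i$ in $\mathbb{E}^n_\nu(\kappa)$ at $\bar p$. *)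

theory Defs
  imports "HOL-Analysis.Analysis"
begin

text \<open>
  A pseudo-Euclidean space is rendered as a type of class \<open>euclidean_space\<close> (an \<open>n\<close>-dimensional
  real vector space with its standard topology, \<open>n = DIM('a)\<close>) together with an arbitrary
  non-degenerate symmetric bilinear form \<open>B\<close>.  The inner product of the type class only provides the
  topology and the differentiable structure; all metric notions refer to \<open>B\<close>.
\<close>

section \<open>Symmetric bilinear forms\<close>

definition orthogonal_basis_of :: "('a::real_vector \<Rightarrow> 'a \<Rightarrow> real) \<Rightarrow> 'a set \<Rightarrow> 'a set \<Rightarrow> bool" where
  "orthogonal_basis_of b W E \<longleftrightarrow>
     independent E \<and> span E = W \<and>
     (\<forall>x\<in>E. \<forall>y\<in>E. x \<noteq> y \<longrightarrow> b x y = 0) \<and> (\<forall>x\<in>E. b x x \<noteq> 0)"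

definition nondegenerate_on :: "('a::real_vector \<Rightarrow> 'a \<Rightarrow> real) \<Rightarrow> 'a set \<Rightarrow> bool" where
  "nondegenerate_on b W \<longleftrightarrow> (\<forall>x\<in>W. (\<forall>y\<in>W. b x y = 0) \<longrightarrow> x = 0)"

definition has_index :: "('a::real_vector \<Rightarrow> 'a \<Rightarrow> real) \<Rightarrow> 'a set \<Rightarrow> nat \<Rightarrow> bool" where
  "has_index b W \<nu> \<longleftrightarrow> (\<exists>E. orthogonal_basis_of b W E \<and> card {x\<in>E. b x x < 0} = \<nu>)"

definition pseudo_euclidean :: "('a::euclidean_space \<Rightarrow> 'a \<Rightarrow> real) \<Rightarrow> nat \<Rightarrow> bool" where
  "pseudo_euclidean B \<nu> \<longleftrightarrow>
     bilinear B \<and> (\<forall>x y. B x y = B y x) \<and> nondegenerate_on B UNIV \<and> has_index B UNIV \<nu>"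

definition form_projection :: "('a::real_vector \<Rightarrow> 'a \<Rightarrow> real) \<Rightarrow> 'a set \<Rightarrow> 'a \<Rightarrow> 'a" where
  "form_projection B W v = (THE w. w \<in> W \<and> (\<forall>u\<in>W. B (v - w) u = 0))"

section \<open>Smooth maps and submanifolds of Euclidean spaces\<close>

primrec times_differentiable_on ::
    "nat \<Rightarrow> 'a::euclidean_space set \<Rightarrow> ('a \<Rightarrow> 'b::euclidean_space) \<Rightarrow> bool" where
  "times_differentiable_on 0 S f \<longleftrightarrow> continuous_on S f"
| "times_differentiable_on (Suc m) S f \<longleftrightarrow>
     (\<forall>x\<in>S. f differentiable (at x)) \<and>
     (\<forall>v. times_differentiable_on m S (\<lambda>x. frechet_derivative f (at x) v))"

text \<open>Only meaningful for open \<open>S\<close>; smooth maps on submanifolds are those that extend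
  smoothly near each point.\<close>

definition smooth_on_open ::
    "'a::euclidean_space set \<Rightarrow> ('a \<Rightarrow> 'b::euclidean_space) \<Rightarrow> bool" where
  "smooth_on_open S f \<longleftrightarrow> (\<forall>m. times_differentiable_on m S f)"

definition smooth_map_on ::
    "'a::euclidean_space set \<Rightarrow> ('a \<Rightarrow> 'b::euclidean_space) \<Rightarrow> bool" where
  "smooth_map_on M f \<longleftrightarrow>
     (\<forall>p\<in>M. \<exists>U F. open U \<and> p \<in> U \<and> smooth_on_open U F \<and> (\<forall>x\<in>M \<inter> U. F x = f x))"

definition submanifold :: "'a::euclidean_space set \<Rightarrow> bool" where
  "submanifold M \<longleftrightarrow>
     (\<exists>d. \<forall>p\<in>M. \<exists>U U' (h::'a \<Rightarrow> 'a) h' W.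
        open U \<and> p \<in> U \<and> open U' \<and> homeomorphism U U' h h' \<and>
        smooth_on_open U h \<and> smooth_on_open U' h' \<and>
        subspace W \<and> dim W = d \<and> h ` (M \<inter> U) = W \<inter> U')"

definition curve_through ::
    "'a::euclidean_space set \<Rightarrow> 'a \<Rightarrow> 'a \<Rightarrow> (real \<Rightarrow> 'a) \<Rightarrow> bool" where
  "curve_through M p v c \<longleftrightarrow>
     (\<exists>e>0. smooth_on_open {-e<..<e} c \<and> c ` {-e<..<e} \<subseteq> M) \<and>
     c 0 = p \<and> (c has_vector_derivative v) (at 0)"

definition tangent_space :: "'a::euclidean_space set \<Rightarrow> 'a \<Rightarrow> 'a set" where
  "tangent_space M p = {v. \<exists>c. curve_through M p v c}"

definition differential ::
    "'a::euclidean_space set \<Rightarrow> ('a \<Rightarrow> 'b::euclidean_space) \<Rightarrow> 'a \<Rightarrow> 'a \<Rightarrow> 'b" where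
  "differential M f p v =
     (THE w. \<exists>c. curve_through M p v c \<and> (f \<circ> c has_vector_derivative w) (at 0))"

definition tangent_field :: "'a::euclidean_space set \<Rightarrow> ('a \<Rightarrow> 'a) \<Rightarrow> bool" where
  "tangent_field M X \<longleftrightarrow> smooth_map_on M X \<and> (\<forall>p\<in>M. X p \<in> tangent_space M p)"

section \<open>Pseudo-Riemannian manifolds and warped products\<close>

text \<open>The metric tensor \<open>g p v w\<close> is relevant only for \<open>p \<in> M\<close> and tangent vectors \<open>v\<close>, \<open>w\<close> at \<open>p\<close>.\<close>

definition pseudo_riemannian ::
    "'a::euclidean_space set \<Rightarrow> ('a \<Rightarrow> 'a \<Rightarrow> 'a \<Rightarrow> real) \<Rightarrow> bool" where
  "pseudo_riemannian M g \<longleftrightarrow>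
     submanifold M \<and>
     (\<forall>p\<in>M. \<forall>u\<in>tangent_space M p. \<forall>v\<in>tangent_space M p. \<forall>w\<in>tangent_space M p. \<forall>r s.
        g p (r *\<^sub>R u + s *\<^sub>R v) w = r * g p u w + s * g p v w \<and> g p v w = g p w v) \<and>
     (\<exists>\<nu>. \<forall>p\<in>M. nondegenerate_on (g p) (tangent_space M p) \<and> has_index (g p) (tangent_space M p) \<nu>) \<and>
     (\<forall>X Y. tangent_field M X \<and> tangent_field M Y \<longrightarrow> smooth_map_on M (\<lambda>p. g p (X p) (Y p)))"

definition induced_metric :: "('a \<Rightarrow> 'a \<Rightarrow> real) \<Rightarrow> 'a \<Rightarrow> 'a \<Rightarrow> 'a \<Rightarrow> real" where
  "induced_metric B p v w = B v w"

definition isometry_between ::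
    "'a::euclidean_space set \<Rightarrow> ('a \<Rightarrow> 'a \<Rightarrow> 'a \<Rightarrow> real) \<Rightarrow>
     'b::euclidean_space set \<Rightarrow> ('b \<Rightarrow> 'b \<Rightarrow> 'b \<Rightarrow> real) \<Rightarrow> ('a \<Rightarrow> 'b) \<Rightarrow> bool" where
  "isometry_between M g N h \<phi> \<longleftrightarrow>
     bij_betw \<phi> M N \<and> smooth_map_on M \<phi> \<and> smooth_map_on N (inv_into M \<phi>) \<and>
     (\<forall>p\<in>M. \<forall>v\<in>tangent_space M p. \<forall>w\<in>tangent_space M p.
        h (\<phi> p) (differential M \<phi> p v) (differential M \<phi> p w) = g p v w)"

text \<open>The factors are \<open>M0\<close> and \<open>M i\<close> for \<open>i :: 'k\<close>, so \<open>k = CARD('k) \<ge> 1\<close>;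
  the product manifold is a subset of the Euclidean space \<open>'a \<times> ('b ^ 'k)\<close>.\<close>

definition product_manifold :: "'a set \<Rightarrow> ('k \<Rightarrow> 'b set) \<Rightarrow> ('a \<times> ('b ^ 'k)) set" where
  "product_manifold M0 M = {(p0, p). p0 \<in> M0 \<and> (\<forall>i. p $ i \<in> M i)}"

definition warped_metric ::
    "('a \<Rightarrow> 'a \<Rightarrow> 'a \<Rightarrow> real) \<Rightarrow> ('k::finite \<Rightarrow> 'a \<Rightarrow> real) \<Rightarrow> ('k \<Rightarrow> 'b \<Rightarrow> 'b \<Rightarrow> 'b \<Rightarrow> real) \<Rightarrow>
     'a \<times> ('b ^ 'k) \<Rightarrow> 'a \<times> ('b ^ 'k) \<Rightarrow> 'a \<times> ('b ^ 'k) \<Rightarrow> real" where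
  "warped_metric g0 \<rho> g p v w =
     g0 (fst p) (fst v) (fst w) +
     (\<Sum>i\<in>UNIV. (\<rho> i (fst p))\<^sup>2 * g i (snd p $ i) (snd v $ i) (snd w $ i))"

definition warped_product_decomposition ::
    "'c::euclidean_space set \<Rightarrow> ('c \<Rightarrow> 'c \<Rightarrow> 'c \<Rightarrow> real) \<Rightarrow>
     'a::euclidean_space set \<Rightarrow> ('a \<Rightarrow> 'a \<Rightarrow> 'a \<Rightarrow> real) \<Rightarrow> ('k::finite \<Rightarrow> 'a \<Rightarrow> real) \<Rightarrow>
     ('k \<Rightarrow> 'b::euclidean_space set) \<Rightarrow> ('k \<Rightarrow> 'b \<Rightarrow> 'b \<Rightarrow> 'b \<Rightarrow> real) \<Rightarrow>
     ('a \<times> ('b ^ 'k) \<Rightarrow> 'c) \<Rightarrow> bool" where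
  "warped_product_decomposition Q h M0 g0 \<rho> M g \<phi> \<longleftrightarrow>
     pseudo_riemannian Q h \<and> pseudo_riemannian M0 g0 \<and> (\<forall>i. pseudo_riemannian (M i) (g i)) \<and>
     (\<forall>i. smooth_map_on M0 (\<rho> i) \<and> (\<forall>x\<in>M0. \<rho> i x > 0)) \<and>
     \<phi> ` product_manifold M0 M \<noteq> {} \<and>
     openin (top_of_set Q) (\<phi> ` product_manifold M0 M) \<and>
     isometry_between (product_manifold M0 M) (warped_metric g0 \<rho> g)
       (\<phi> ` product_manifold M0 M) h \<phi>"

text \<open>Leaves through a point \<open>q\<close> of the image: vary one coordinate of \<open>\<phi>\<inverse>(q)\<close>.\<close>

definition base_leaf :: "'a set \<Rightarrow> ('k \<Rightarrow> 'b set) \<Rightarrow> ('a \<times> ('b ^ 'k) \<Rightarrow> 'c) \<Rightarrow> 'c \<Rightarrow> 'c set" where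
  "base_leaf M0 M \<phi> q =
     (let r = inv_into (product_manifold M0 M) \<phi> q in (\<lambda>x. \<phi> (x, snd r)) ` M0)"

definition leaf ::
    "'a set \<Rightarrow> ('k \<Rightarrow> 'b set) \<Rightarrow> ('a \<times> ('b ^ 'k) \<Rightarrow> 'c) \<Rightarrow> 'k \<Rightarrow> 'c \<Rightarrow> 'c set" where
  "leaf M0 M \<phi> i q =
     (let r = inv_into (product_manifold M0 M) \<phi> q
      in (\<lambda>x. \<phi> (fst r, \<chi> j. if j = i then x else snd r $ j)) ` M i)"

section \<open>Mean curvature\<close>

text \<open>For \<open>L \<subseteq> M\<close>, both with the metric induced by \<open>B\<close>: the Levi-Civita derivative on \<open>M\<close> is the
  tangential part of the flat derivative, the second fundamental form \<open>II(x, y)\<close> of \<open>L\<close> in \<open>M\<close> is the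
  part of \<open>\<nabla>\<^sub>x Y\<close> normal to \<open>L\<close> for any tangent field \<open>Y\<close> of \<open>L\<close> extending \<open>y\<close>, and
  the mean curvature vector is its trace divided by \<open>dim L\<close>.\<close>

definition covariant_derivative ::
    "('a::euclidean_space \<Rightarrow> 'a \<Rightarrow> real) \<Rightarrow> 'a set \<Rightarrow> 'a set \<Rightarrow> ('a \<Rightarrow> 'a) \<Rightarrow> 'a \<Rightarrow> 'a \<Rightarrow> 'a" where
  "covariant_derivative B M L Y p x =
     form_projection B (tangent_space M p) (differential L Y p x)"

definition second_fundamental_form ::
    "('a::euclidean_space \<Rightarrow> 'a \<Rightarrow> real) \<Rightarrow> 'a set \<Rightarrow> 'a set \<Rightarrow> 'a \<Rightarrow> 'a \<Rightarrow> 'a \<Rightarrow> 'a" where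
  "second_fundamental_form B M L p x y =
     (THE w. \<exists>Y. tangent_field L Y \<and> Y p = y \<and>
        w = covariant_derivative B M L Y p x -
            form_projection B (tangent_space L p) (covariant_derivative B M L Y p x))"

definition mean_curvature_vector ::
    "('a::euclidean_space \<Rightarrow> 'a \<Rightarrow> real) \<Rightarrow> 'a set \<Rightarrow> 'a set \<Rightarrow> 'a \<Rightarrow> 'a" where
  "mean_curvature_vector B M L p =
     (THE H. \<exists>E. orthogonal_basis_of B (tangent_space L p) E \<and>
        H = (1 / real (card E)) *\<^sub>R
            (\<Sum>e\<in>E. (1 / B e e) *\<^sub>R second_fundamental_form B M L p e e))"

section \<open>Initial data and the corresponding decompositions\<close>

definition hyperquadric :: "('a::euclidean_space \<Rightarrow> 'a \<Rightarrow> real) \<Rightarrow> real \<Rightarrow> 'a set" where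
  "hyperquadric B \<kappa> = {p. B p p = 1 / \<kappa>}"

definition orthogonal_decomposition ::
    "('a::real_vector \<Rightarrow> 'a \<Rightarrow> real) \<Rightarrow> 'a set \<Rightarrow> 'a set \<Rightarrow> ('k::finite \<Rightarrow> 'a set) \<Rightarrow> bool" where
  "orthogonal_decomposition B T V0 V \<longleftrightarrow>
     subspace V0 \<and> V0 \<noteq> {0} \<and> (\<forall>i. subspace (V i) \<and> V i \<noteq> {0}) \<and>
     T = {v0 + (\<Sum>i\<in>UNIV. v i) | v0 v. v0 \<in> V0 \<and> (\<forall>i. v i \<in> V i)} \<and>
     (\<forall>v0 v. v0 \<in> V0 \<and> (\<forall>i. v i \<in> V i) \<and> v0 + (\<Sum>i\<in>UNIV. v i) = 0 \<longrightarrow>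
        v0 = 0 \<and> (\<forall>i. v i = 0)) \<and>
     (\<forall>i. \<forall>x\<in>V0. \<forall>y\<in>V i. B x y = 0) \<and>
     (\<forall>i j. i \<noteq> j \<longrightarrow> (\<forall>x\<in>V i. \<forall>y\<in>V j. B x y = 0))"

definition hyperquadric_initial_data ::
    "('a::euclidean_space \<Rightarrow> 'a \<Rightarrow> real) \<Rightarrow> real \<Rightarrow>
     'a \<Rightarrow> 'a set \<Rightarrow> ('k::finite \<Rightarrow> 'a set) \<Rightarrow> ('k \<Rightarrow> 'a) \<Rightarrow> bool" where
  "hyperquadric_initial_data B \<kappa> pbar V0 V a \<longleftrightarrow>
     pbar \<in> hyperquadric B \<kappa> \<and>
     orthogonal_decomposition B (tangent_space (hyperquadric B \<kappa>) pbar) V0 V \<and>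
     (\<exists>z. (\<forall>i. z i \<in> V0 \<and> a i = \<kappa> *\<^sub>R pbar - z i) \<and> (\<forall>i j. i \<noteq> j \<longrightarrow> B (z i) (z j) = - \<kappa>)) \<and>
     inj a \<and> independent (range a)"

definition wp_scale :: "('a::euclidean_space \<Rightarrow> 'a \<Rightarrow> real) \<Rightarrow> 'a \<Rightarrow> ('k \<Rightarrow> 'a) \<Rightarrow> 'k \<Rightarrow> 'a \<Rightarrow> real" where
  "wp_scale B pbar a i p0 = 1 + B (a i) (p0 - pbar)"

definition wp_base ::
    "('a::euclidean_space \<Rightarrow> 'a \<Rightarrow> real) \<Rightarrow> 'a \<Rightarrow> 'a set \<Rightarrow> ('k \<Rightarrow> 'a) \<Rightarrow> 'a set" where
  "wp_base B pbar U0 a = {p0 \<in> (+) pbar ` U0. \<forall>i. wp_scale B pbar a i p0 > 0}"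

text \<open>\<open>span (insert (a i) (U i))\<close> is \<open>\<real>a\<^sub>i \<oplus> U\<^sub>i\<close>; as \<open>a\<^sub>i \<noteq> 0\<close> for initial data,
  the second case is the lightlike one.\<close>

definition wp_fibre ::
    "('a::euclidean_space \<Rightarrow> 'a \<Rightarrow> real) \<Rightarrow> 'a \<Rightarrow> ('k \<Rightarrow> 'a set) \<Rightarrow> ('k \<Rightarrow> 'a) \<Rightarrow> 'k \<Rightarrow> 'a set" where
  "wp_fibre B pbar U a i =
     (let \<kappa>i = B (a i) (a i) in
      if \<kappa>i \<noteq> 0
      then (+) (pbar - (1 / \<kappa>i) *\<^sub>R a i) ` {p \<in> span (insert (a i) (U i)). B p p = 1 / \<kappa>i}
      else (+) pbar ` {p - (1 / 2 * B p p) *\<^sub>R a i | p. p \<in> U i})"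

definition wp_map ::
    "('a::euclidean_space \<Rightarrow> 'a \<Rightarrow> real) \<Rightarrow> 'a \<Rightarrow> ('k::finite \<Rightarrow> 'a) \<Rightarrow> 'a \<times> ('a ^ 'k) \<Rightarrow> 'a" where
  "wp_map B pbar a = (\<lambda>(p0, p). p0 + (\<Sum>i\<in>UNIV. wp_scale B pbar a i p0 *\<^sub>R (p $ i - pbar)))"

definition determined_by ::
    "('a::euclidean_space \<Rightarrow> 'a \<Rightarrow> real) \<Rightarrow> real \<Rightarrow>
     'a set \<Rightarrow> ('k::finite \<Rightarrow> 'a set) \<Rightarrow> ('a \<times> ('a ^ 'k) \<Rightarrow> 'a) \<Rightarrow>
     'a \<Rightarrow> 'a set \<Rightarrow> ('k \<Rightarrow> 'a set) \<Rightarrow> ('k \<Rightarrow> 'a) \<Rightarrow> bool" where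
  "determined_by B \<kappa> M0 M \<phi> pbar V0 V a \<longleftrightarrow>
     pbar \<in> \<phi> ` product_manifold M0 M \<and>
     tangent_space (base_leaf M0 M \<phi> pbar) pbar = V0 \<and>
     (\<forall>i. tangent_space (leaf M0 M \<phi> i pbar) pbar = V i \<and>
          mean_curvature_vector B (hyperquadric B \<kappa>) (leaf M0 M \<phi> i pbar) pbar = \<kappa> *\<^sub>R pbar - a i)"

end

theory Submission
  imports Defs
begin

text \<open>
  The initial data give \<open>B (a i) pbar = 1\<close> and \<open>B v pbar = 0\<close> for \<open>v \<in> V i\<close>.  Hence the warping
  functions are the linear forms \<open>B (a i)\<close>, and every fibre, lightlike \<open>a i\<close> or not, is the section of
  the hyperquadric by the affine space \<open>pbar + span (insert (a i) (V i))\<close>.  So the hyperquadric, the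
  base and the fibres are all sections of one quadric by affine spaces.  Such a section carries a
  field \<open>n\<close> with \<open>B x (n x) = 1\<close> that is orthogonal to its tangent spaces and has constant norm; this
  yields charts, constancy of the index (by Sylvester's law, adjoining \<open>n x\<close> to an orthogonal basis
  of the tangent space) and umbilicity with mean curvature vector \<open>\<kappa> x - n x\<close>.

  The map satisfies \<open>B (\<psi> (p0, p)) (\<psi> (p0, p)) = B p0 p0\<close>, so it maps into the hyperquadric, and it has
  an explicit smooth inverse on an open set, because each warping factor can be recovered from the
  image point by a square root.
\<close>

section \<open>Smooth maps and tangent vectors\<close>

text \<open>\<open>B (a i) pbar = 1\<close> holds because
  \<open>a i = \<kappa> *\<^sub>R pbar - z i\<close> with \<open>z i\<close> orthogonal to
  \<open>pbar\<close> and \<open>B pbar pbar = 1 / \<kappa>\<close>. Hence \<open>B y pbar\<close>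
  reads off the \<open>a i\<close>-coordinate of \<open>y\<close> in \<open>W i\<close>, which
  pairing with \<open>a i\<close> itself cannot do once \<open>a i\<close> is lightlike. Lightlike
  \<open>a i\<close> are the obstacle: the form on \<open>W i\<close> is then degenerate with
  radical spanned by \<open>a i\<close>, and the fibre has no centre and no radial normal. The field
  \<open>\<kappa>' i *\<^sub>R (x - pbar) + a i\<close> covers both cases: it is
  \<open>\<kappa>' i\<close> times the position relative to the centre
  \<open>pbar - (1 / \<kappa>' i) *\<^sub>R a i\<close> where that exists, and the constant
  \<open>a i\<close> otherwise. Normalising by \<open>B x (n x) = 1\<close> instead of unit length
  stays meaningful for null \<open>n x\<close>. The value at \<open>pbar\<close> is
  \<open>a i\<close>, which is how the prescribed mean curvature vector arises. Sections may be
  disconnected, so their index cannot be propagated by continuity; the fixed space \<open>W\<close>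
  makes the tangent spaces at different points comparable. Charts and inverses are explicit formulas
  on open subsets of the ambient space, so no inverse function theorem enters.\<close>

lemma frechet_derivative_eqI: "(f has_derivative f') (at x) \<Longrightarrow> frechet_derivative f (at x) = f'"
  by (rule frechet_derivative_at [symmetric])

lemma times_differentiable_on_cong:
  assumes "times_differentiable_on m S f" and "open S" and "\<And>x. x \<in> S \<Longrightarrow> f x = g x"
  shows "times_differentiable_on m S g"
  using assms
proof (induction m arbitrary: f g)
  case 0
  then show ?case using continuous_on_cong by (metis times_differentiable_on.simps(1))
next
  case (Suc m)
  have *: "(g has_derivative frechet_derivative f (at x)) (at x)" if "x \<in> S" for x
  proof (rule has_derivative_transform_within_open[OF _ \<open>open S\<close> that])
    show "(f has_derivative frechet_derivative f (at x)) (at x)"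
      using Suc.prems(1) that frechet_derivative_works by auto
  qed (use Suc.prems in auto)
  have "times_differentiable_on m S (\<lambda>x. frechet_derivative g (at x) v)" for v
  proof (rule Suc.IH)
    show "times_differentiable_on m S (\<lambda>x. frechet_derivative f (at x) v)"
      using Suc.prems(1) by simp
  qed (use \<open>open S\<close> frechet_derivative_eqI[OF *] in auto)
  then show ?case using * by (auto simp: differentiable_def)
qed

lemma times_differentiable_on_derivI:
  assumes "open S"
    and "\<And>x. x \<in> S \<Longrightarrow> (f has_derivative f' x) (at x)"
    and "\<And>v. times_differentiable_on m S (\<lambda>x. f' x v)"
  shows "times_differentiable_on (Suc m) S f"
proof -
  have "times_differentiable_on m S (\<lambda>x. frechet_derivative f (at x) v)" for v
    by (rule times_differentiable_on_cong[OF assms(3)[of v] \<open>open S\<close>])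
      (simp add: frechet_derivative_eqI[OF assms(2)])
  then show ?thesis using assms(2) by (auto simp: differentiable_def)
qed

text \<open>The product rule leaves one factor undifferentiated, and that factor must be known to
  have the lower order; the derivation rules below rely on this.\<close>

lemma times_differentiable_on_SucD:
  assumes "times_differentiable_on (Suc m) S f"
  shows "times_differentiable_on m S f"
  using assms
proof (induction m arbitrary: f)
  case 0
  then have "continuous (at x within S) f" if "x \<in> S" for x
    using that by (simp add: differentiable_imp_continuous_within continuous_at_imp_continuous_at_within)
  then show ?case by (simp add: continuous_on_eq_continuous_within)
next
  case (Suc m)
  have "times_differentiable_on (Suc m) S (\<lambda>x. frechet_derivative f (at x) v)" for v
    using Suc.prems times_differentiable_on.simps(2)[of "Suc m" S f] by blast
  then have "times_differentiable_on m S (\<lambda>x. frechet_derivative f (at x) v)" for v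
    by (rule Suc.IH)
  then show ?case
    using Suc.prems times_differentiable_on.simps(2)[of "Suc m" S f]
      times_differentiable_on.simps(2)[of m S f] by blast
qed

lemma times_differentiable_on_has_derivative:
  assumes "times_differentiable_on (Suc m) S f" and "x \<in> S"
  shows "(f has_derivative frechet_derivative f (at x)) (at x)"
  using assms frechet_derivative_works by auto

lemma times_differentiable_on_subset:
  assumes "times_differentiable_on m S f" and "T \<subseteq> S"
  shows "times_differentiable_on m T f"
  using assms by (induction m arbitrary: f) (auto intro: continuous_on_subset)

lemma times_differentiable_on_const: "times_differentiable_on m S (\<lambda>x. c)"
  by (induction m arbitrary: c) (auto simp: frechet_derivative_const)

lemma times_differentiable_on_bounded_linear:
  assumes "open S" and L: "bounded_linear L" and "times_differentiable_on m S f"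
  shows "times_differentiable_on m S (\<lambda>x. L (f x))"
  using assms(3)
proof (induction m arbitrary: f)
  case 0
  then show ?case using L by (auto intro: bounded_linear.continuous_on)
next
  case (Suc m)
  show ?case
    by (rule times_differentiable_on_derivI[OF \<open>open S\<close>])
      (use Suc.prems in \<open>auto intro!: Suc.IH bounded_linear.has_derivative[OF L]
         times_differentiable_on_has_derivative[OF Suc.prems]\<close>)
qed

lemma times_differentiable_on_id: "open S \<Longrightarrow> times_differentiable_on m S (\<lambda>x. x)"
  by (cases m) (auto simp del: times_differentiable_on.simps(2)
      intro!: times_differentiable_on_derivI[OF _ has_derivative_ident] times_differentiable_on_const)

lemma times_differentiable_on_add:
  assumes "open S" and "times_differentiable_on m S f" and "times_differentiable_on m S g"
  shows "times_differentiable_on m S (\<lambda>x. f x + g x)"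
  using assms(2,3)
proof (induction m arbitrary: f g)
  case 0
  then show ?case by (auto intro: continuous_on_add)
next
  case (Suc m)
  show ?case
    by (rule times_differentiable_on_derivI[OF \<open>open S\<close>])
      (use Suc.prems in \<open>auto intro!: Suc.IH has_derivative_add
         times_differentiable_on_has_derivative[OF Suc.prems(1)]
         times_differentiable_on_has_derivative[OF Suc.prems(2)]\<close>)
qed

lemma times_differentiable_on_bilinear:
  assumes "open S" and P: "bounded_bilinear P"
    and "times_differentiable_on m S f" and "times_differentiable_on m S g"
  shows "times_differentiable_on m S (\<lambda>x. P (f x) (g x))"
  using assms(3,4)
proof (induction m arbitrary: f g)
  case 0
  then show ?case using P by (auto intro: bounded_bilinear.continuous_on)
next
  case (Suc m)
  show ?case
  proof (rule times_differentiable_on_derivI[OF \<open>open S\<close>])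
    fix x assume "x \<in> S"
    then show "((\<lambda>x. P (f x) (g x)) has_derivative
        (\<lambda>v. P (f x) (frechet_derivative g (at x) v) + P (frechet_derivative f (at x) v) (g x))) (at x)"
      by (intro bounded_bilinear.FDERIV[OF P] times_differentiable_on_has_derivative[OF Suc.prems(1)]
         times_differentiable_on_has_derivative[OF Suc.prems(2)])
  qed (use Suc.prems times_differentiable_on_SucD[OF Suc.prems(1)]
      times_differentiable_on_SucD[OF Suc.prems(2)] \<open>open S\<close> in
      \<open>auto intro!: Suc.IH times_differentiable_on_add\<close>)
qed

lemma times_differentiable_on_inverse:
  fixes f :: "'a::euclidean_space \<Rightarrow> real"
  assumes "open S" and "times_differentiable_on m S f" and "\<And>x. x \<in> S \<Longrightarrow> f x \<noteq> 0"
  shows "times_differentiable_on m S (\<lambda>x. inverse (f x))"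
  using assms(2,3)
proof (induction m arbitrary: f)
  case 0
  then show ?case by (auto intro: continuous_on_inverse)
next
  case (Suc m)
  \<comment> \<open>The derivative of the reciprocal contains the reciprocal again; the induction
    hypothesis for the same \<open>f\<close> at lower order breaks the circle. The square root is
    handled in the same way.\<close>
  have *: "times_differentiable_on m S (\<lambda>x. inverse (f x))"
    by (rule Suc.IH[OF times_differentiable_on_SucD[OF Suc.prems(1)] Suc.prems(2)])
  show ?case
  proof (rule times_differentiable_on_derivI[OF \<open>open S\<close>])
    fix x assume "x \<in> S"
    then show "((\<lambda>x. inverse (f x)) has_derivative
        (\<lambda>v. - (inverse (f x) * frechet_derivative f (at x) v * inverse (f x)))) (at x)"
      by (intro Deriv.has_derivative_inverse times_differentiable_on_has_derivative[OF Suc.prems(1)] Suc.prems)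
  next
    fix v
    have "times_differentiable_on m S (\<lambda>x. inverse (f x) * frechet_derivative f (at x) v * inverse (f x))"
      using Suc.prems(1) by (intro times_differentiable_on_bilinear[OF \<open>open S\<close> bounded_bilinear_mult] *) auto
    then show "times_differentiable_on m S (\<lambda>x. - (inverse (f x) * frechet_derivative f (at x) v * inverse (f x)))"
      by (rule times_differentiable_on_bounded_linear[OF \<open>open S\<close> bounded_linear_minus[OF bounded_linear_ident]])
  qed
qed

lemma times_differentiable_on_sqrt:
  fixes f :: "'a::euclidean_space \<Rightarrow> real"
  assumes "open S" and "times_differentiable_on m S f" and "\<And>x. x \<in> S \<Longrightarrow> f x > 0"
  shows "times_differentiable_on m S (\<lambda>x. sqrt (f x))"
  using assms(2,3)
proof (induction m arbitrary: f)
  case 0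
  then show ?case by (auto intro: continuous_on_real_sqrt)
next
  case (Suc m)
  have *: "times_differentiable_on m S (\<lambda>x. sqrt (f x))"
    by (rule Suc.IH[OF times_differentiable_on_SucD[OF Suc.prems(1)] Suc.prems(2)])
  show ?case
  proof (rule times_differentiable_on_derivI[OF \<open>open S\<close>])
    fix x assume x: "x \<in> S"
    show "((\<lambda>x. sqrt (f x)) has_derivative
        (\<lambda>v. frechet_derivative f (at x) v * (inverse (sqrt (f x)) / 2))) (at x)"
      using has_derivative_real_sqrt[OF Suc.prems(2)[OF x] times_differentiable_on_has_derivative[OF Suc.prems(1) x]]
      by (simp add: field_simps)
  next
    fix v
    have "times_differentiable_on m S (\<lambda>x. inverse (sqrt (f x)))"
      using Suc.prems(2) by (intro times_differentiable_on_inverse \<open>open S\<close> *) fastforce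
    then show "times_differentiable_on m S (\<lambda>x. frechet_derivative f (at x) v * (inverse (sqrt (f x)) / 2))"
      using Suc.prems(1)
      by (intro times_differentiable_on_bilinear[OF \<open>open S\<close> bounded_bilinear_mult]
          times_differentiable_on_bounded_linear[OF \<open>open S\<close> bounded_linear_divide]) auto
  qed
qed

section \<open>Closure properties of smooth functions on open sets\<close>

lemma smooth_on_open_const: "smooth_on_open S (\<lambda>x. c)"
  unfolding smooth_on_open_def by (auto intro: times_differentiable_on_const)

lemma smooth_on_open_id: "open S \<Longrightarrow> smooth_on_open S (\<lambda>x. x)"
  unfolding smooth_on_open_def by (auto intro: times_differentiable_on_id)

lemma smooth_on_open_bounded_linear:
  "open S \<Longrightarrow> bounded_linear L \<Longrightarrow> smooth_on_open S f \<Longrightarrow> smooth_on_open S (\<lambda>x. L (f x))"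
  unfolding smooth_on_open_def by (auto intro: times_differentiable_on_bounded_linear)

lemma smooth_on_open_bilinear:
  "open S \<Longrightarrow> bounded_bilinear P \<Longrightarrow> smooth_on_open S f \<Longrightarrow> smooth_on_open S g \<Longrightarrow>
    smooth_on_open S (\<lambda>x. P (f x) (g x))"
  unfolding smooth_on_open_def by (auto intro: times_differentiable_on_bilinear)

lemma smooth_on_open_add:
  "open S \<Longrightarrow> smooth_on_open S f \<Longrightarrow> smooth_on_open S g \<Longrightarrow> smooth_on_open S (\<lambda>x. f x + g x)"
  unfolding smooth_on_open_def by (auto intro: times_differentiable_on_add)

lemma smooth_on_open_minus:
  "open S \<Longrightarrow> smooth_on_open S f \<Longrightarrow> smooth_on_open S (\<lambda>x. - f x)"
  by (rule smooth_on_open_bounded_linear[OF _ bounded_linear_minus[OF bounded_linear_ident]])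

lemma smooth_on_open_diff:
  "open S \<Longrightarrow> smooth_on_open S f \<Longrightarrow> smooth_on_open S g \<Longrightarrow> smooth_on_open S (\<lambda>x. f x - g x)"
  unfolding diff_conv_add_uminus by (intro smooth_on_open_add smooth_on_open_minus)

lemma smooth_on_open_sum:
  assumes "open S" and "\<And>i. i \<in> I \<Longrightarrow> smooth_on_open S (f i)"
  shows "smooth_on_open S (\<lambda>x. \<Sum>i\<in>I. f i x)"
  using assms(2)
  by (induction I rule: infinite_finite_induct)
    (auto intro: smooth_on_open_const smooth_on_open_add[OF assms(1)])

lemma smooth_on_open_scaleR:
  "open S \<Longrightarrow> smooth_on_open S f \<Longrightarrow> smooth_on_open S g \<Longrightarrow> smooth_on_open S (\<lambda>x. f x *\<^sub>R g x)"
  by (rule smooth_on_open_bilinear[OF _ bounded_bilinear_scaleR])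

lemma smooth_on_open_mult:
  fixes f g :: "'a::euclidean_space \<Rightarrow> real"
  shows "open S \<Longrightarrow> smooth_on_open S f \<Longrightarrow> smooth_on_open S g \<Longrightarrow> smooth_on_open S (\<lambda>x. f x * g x)"
  by (rule smooth_on_open_bilinear[OF _ bounded_bilinear_mult])

lemma smooth_on_open_divide:
  fixes f g :: "'a::euclidean_space \<Rightarrow> real"
  assumes "open S" and "smooth_on_open S f" and "smooth_on_open S g" and "\<And>x. x \<in> S \<Longrightarrow> g x \<noteq> 0"
  shows "smooth_on_open S (\<lambda>x. f x / g x)"
proof -
  have "smooth_on_open S (\<lambda>x. inverse (g x))"
    using assms unfolding smooth_on_open_def by (auto intro: times_differentiable_on_inverse)
  then show ?thesis
    using smooth_on_open_mult[OF assms(1,2)] by (simp add: divide_inverse)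
qed

lemma smooth_on_open_sqrt:
  fixes f :: "'a::euclidean_space \<Rightarrow> real"
  shows "open S \<Longrightarrow> smooth_on_open S f \<Longrightarrow> (\<And>x. x \<in> S \<Longrightarrow> f x > 0) \<Longrightarrow> smooth_on_open S (\<lambda>x. sqrt (f x))"
  unfolding smooth_on_open_def by (auto intro: times_differentiable_on_sqrt)

lemma smooth_on_open_Pair:
  assumes "open S" and "smooth_on_open S f" and "smooth_on_open S g"
  shows "smooth_on_open S (\<lambda>x. (f x, g x))"
proof -
  have "smooth_on_open S (\<lambda>x. (f x, 0))"
    by (rule smooth_on_open_bounded_linear[OF assms(1) _ assms(2)])
      (rule bounded_linear_Pair[OF bounded_linear_ident bounded_linear_zero])
  moreover have "smooth_on_open S (\<lambda>x. (0, g x))"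
    by (rule smooth_on_open_bounded_linear[OF assms(1) _ assms(3)])
      (rule bounded_linear_Pair[OF bounded_linear_zero bounded_linear_ident])
  ultimately show ?thesis
    using smooth_on_open_add[OF assms(1)] by fastforce
qed

lemma smooth_on_open_vec:
  fixes f :: "'k::finite \<Rightarrow> 'a::euclidean_space \<Rightarrow> 'b::euclidean_space"
  assumes "open S" and "\<And>i. smooth_on_open S (f i)"
  shows "smooth_on_open S (\<lambda>x. \<chi> i. f i x)"
proof -
  have lin: "bounded_linear (axis i :: 'b \<Rightarrow> 'b ^ 'k)" for i
    by (rule linear_conv_bounded_linear[THEN iffD1])
      (auto intro!: linearI simp: axis_def vec_eq_iff)
  have "smooth_on_open S (\<lambda>x. \<Sum>i\<in>UNIV. axis i (f i x))"
    by (rule smooth_on_open_sum[OF assms(1)])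
      (rule smooth_on_open_bounded_linear[OF assms(1) lin assms(2)])
  moreover have "(\<lambda>x. \<chi> i. f i x) = (\<lambda>x. \<Sum>i\<in>UNIV. axis i (f i x))"
    by (auto simp: fun_eq_iff vec_eq_iff axis_def if_distrib sum.delta cong: if_cong)
  ultimately show ?thesis by simp
qed

lemmas smooth_intros = smooth_on_open_const smooth_on_open_id smooth_on_open_add smooth_on_open_diff
  smooth_on_open_minus smooth_on_open_sum smooth_on_open_scaleR smooth_on_open_mult
  smooth_on_open_divide smooth_on_open_sqrt smooth_on_open_Pair smooth_on_open_vec

lemma smooth_on_open_has_derivative:
  assumes "smooth_on_open S f" and "x \<in> S"
  shows "(f has_derivative frechet_derivative f (at x)) (at x)"
  using assms times_differentiable_on_has_derivative unfolding smooth_on_open_def by blast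

lemma smooth_on_open_continuous_on: "smooth_on_open S f \<Longrightarrow> continuous_on S f"
  unfolding smooth_on_open_def by (metis times_differentiable_on.simps(1))

lemma smooth_on_open_subset: "smooth_on_open S f \<Longrightarrow> T \<subseteq> S \<Longrightarrow> smooth_on_open T f"
  unfolding smooth_on_open_def by (auto intro: times_differentiable_on_subset)

section \<open>Smooth maps on subsets, and tangent vectors as velocities of curves\<close>

lemma smooth_map_onI:
  assumes "open U" and "M \<subseteq> U" and "smooth_on_open U F" and "\<And>x. x \<in> M \<Longrightarrow> F x = f x"
  shows "smooth_map_on M f"
  unfolding smooth_map_on_def using assms by blast

lemma smooth_map_on_bilinear:
  assumes P: "bounded_bilinear P" and "smooth_map_on M f" and "smooth_map_on M g"
  shows "smooth_map_on M (\<lambda>x. P (f x) (g x))"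
  unfolding smooth_map_on_def
proof
  fix p assume "p \<in> M"
  then obtain U F V G where "open U" "p \<in> U" "smooth_on_open U F" "\<forall>x\<in>M \<inter> U. F x = f x"
    and "open V" "p \<in> V" "smooth_on_open V G" "\<forall>x\<in>M \<inter> V. G x = g x"
    using assms(2,3) unfolding smooth_map_on_def by meson
  then show "\<exists>U F. open U \<and> p \<in> U \<and> smooth_on_open U F \<and> (\<forall>x\<in>M \<inter> U. F x = P (f x) (g x))"
    by (intro exI[of _ "U \<inter> V"] exI[of _ "\<lambda>x. P (F x) (G x)"])
      (auto intro!: smooth_on_open_bilinear[OF _ P] intro: smooth_on_open_subset)
qed

text \<open>Near 0 the curve stays in \<open>M\<close> and in \<open>U\<close>, so \<open>f\<close>
  may be replaced there by the ambient extension \<open>F\<close> and the chain rule applies to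
  \<open>F\<close>. Besides computing differentials, this differentiates identities that hold only
  on \<open>M\<close>: one side is taken as \<open>F\<close>, the other as \<open>f\<close>.\<close>

lemma curve_through_compose:
  assumes c: "curve_through M p v c" and "open U" "p \<in> U" and F: "(F has_derivative F') (at p)"
    and eq: "\<And>x. x \<in> M \<inter> U \<Longrightarrow> F x = f x"
  shows "(f \<circ> c has_vector_derivative F' v) (at 0)"
proof -
  obtain e where e: "e > 0" "c ` {-e<..<e} \<subseteq> M" and c0: "c 0 = p"
    and dc: "(c has_vector_derivative v) (at 0)"
    using c unfolding curve_through_def by blast
  have "isCont c 0"
    using dc has_vector_derivative_continuous by blast
  then have "eventually (\<lambda>t. c t \<in> U) (at 0)"
    using assms(2,3) c0 by (simp add: isCont_def topological_tendstoD)
  moreover have "eventually (\<lambda>t. c t \<in> M) (at 0)"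
    unfolding eventually_at by (rule exI[of _ e]) (use e in \<open>auto simp: dist_real_def abs_less_iff\<close>)
  ultimately have ev: "eventually (\<lambda>t. (F \<circ> c) t = (f \<circ> c) t) (at 0)"
    by eventually_elim (use eq in auto)
  have "p \<in> M" using e c0 by (auto simp: image_subset_iff)
  have "(F \<circ> c has_derivative (\<lambda>t. F' (t *\<^sub>R v))) (at 0)"
    using diff_chain_at[of c "\<lambda>t. t *\<^sub>R v" 0 F F'] dc F c0
    by (simp add: has_vector_derivative_def comp_def)
  then have "(F \<circ> c has_vector_derivative F' v) (at 0)"
    using has_derivative_bounded_linear[OF F]
    by (simp add: has_vector_derivative_def linear_simps)
  then show ?thesis
    unfolding has_vector_derivative_def
    by (rule has_derivative_transform_eventually[OF _ ev]) (use eq \<open>p \<in> M\<close> \<open>p \<in> U\<close> c0 in auto)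
qed

text \<open>The definite description denotes, because the value \<open>F' v\<close> depends neither
  on the curve nor, by uniqueness of derivatives, on the extension.\<close>

lemma differential_eqI:
  assumes "v \<in> tangent_space M p" and "open U" "p \<in> U" and "(F has_derivative F') (at p)"
    and "\<And>x. x \<in> M \<inter> U \<Longrightarrow> F x = f x"
  shows "differential M f p v = F' v"
  unfolding differential_def
proof (rule the_equality)
  obtain c where c: "curve_through M p v c"
    using assms(1) unfolding tangent_space_def by blast
  then show "\<exists>c. curve_through M p v c \<and> (f \<circ> c has_vector_derivative F' v) (at 0)"
    using curve_through_compose[OF c assms(2-5)] by blast
next
  fix w assume "\<exists>c. curve_through M p v c \<and> (f \<circ> c has_vector_derivative w) (at 0)"
  then show "w = F' v"
    using curve_through_compose[OF _ assms(2-5)] vector_derivative_unique_at by metis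
qed

lemma tangent_space_bounded_linear_image:
  assumes L: "bounded_linear L" and "v \<in> tangent_space M p" and "L ` M \<subseteq> M'"
  shows "L v \<in> tangent_space M' (L p)"
proof -
  obtain c e where c: "e > 0" "smooth_on_open {-e<..<e} c" "c ` {-e<..<e} \<subseteq> M"
    "c 0 = p" "(c has_vector_derivative v) (at 0)"
    using assms(2) unfolding tangent_space_def curve_through_def by blast
  have "curve_through M' (L p) (L v) (\<lambda>t. L (c t))"
    unfolding curve_through_def using c assms(3)
    by (auto intro!: exI[of _ e] smooth_on_open_bounded_linear[OF _ L]
        bounded_linear.has_vector_derivative[OF L])
  then show ?thesis unfolding tangent_space_def by blast
qed

text \<open>Difference quotients at 0 lie in \<open>W\<close>, and a subspace of a
  finite-dimensional space is closed.\<close>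

lemma vector_derivative_in_subspace:
  fixes c :: "real \<Rightarrow> 'a::euclidean_space"
  assumes dc: "(c has_vector_derivative v) (at 0)" and "subspace W" and "e > 0"
    and c: "\<And>t. t \<in> {-e<..<e} \<Longrightarrow> c t - c 0 \<in> W"
  shows "v \<in> W"
proof -
  have "((\<lambda>t. norm (c t - c 0 - t *\<^sub>R v) / norm t) \<longlongrightarrow> 0) (at 0)"
    using dc by (simp add: has_vector_derivative_def has_derivative_at)
  moreover have "eventually (\<lambda>t. norm (c t - c 0 - t *\<^sub>R v) / norm t = norm (inverse t *\<^sub>R (c t - c 0) - v)) (at 0)"
    unfolding eventually_at
  proof (intro exI[of _ 1] conjI ballI impI)
    fix t :: real assume "t \<noteq> 0 \<and> dist t 0 < 1"
    then have "inverse t *\<^sub>R (c t - c 0) - v = inverse t *\<^sub>R (c t - c 0 - t *\<^sub>R v)"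
      by (simp add: scaleR_diff_right)
    then show "norm (c t - c 0 - t *\<^sub>R v) / norm t = norm (inverse t *\<^sub>R (c t - c 0) - v)"
      by (simp add: divide_inverse)
  qed simp
  ultimately have "((\<lambda>t. norm (inverse t *\<^sub>R (c t - c 0) - v)) \<longlongrightarrow> 0) (at 0)"
    by (rule Lim_transform_eventually)
  then have "((\<lambda>t. inverse t *\<^sub>R (c t - c 0)) \<longlongrightarrow> v) (at 0)"
    using LIM_zero_cancel tendsto_norm_zero_iff by blast
  moreover have "eventually (\<lambda>t. inverse t *\<^sub>R (c t - c 0) \<in> W) (at 0)"
    unfolding eventually_at
    by (rule exI[of _ e]) (use assms in \<open>auto simp: dist_real_def abs_less_iff intro!: subspace_scale\<close>)
  ultimately show ?thesis
    by (intro Lim_in_closed_set[OF closed_subspace[OF \<open>subspace W\<close>] _ at_neq_bot])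
qed

lemma tangent_space_subset_subspace:
  assumes "v \<in> tangent_space M p" and "subspace W" and "\<And>x. x \<in> M \<Longrightarrow> x - p \<in> W"
  shows "v \<in> W"
proof -
  obtain c e where c: "e > 0" "c ` {-e<..<e} \<subseteq> M" "c 0 = p" "(c has_vector_derivative v) (at 0)"
    using assms(1) unfolding tangent_space_def curve_through_def by blast
  show ?thesis
    by (rule vector_derivative_in_subspace[OF c(4) assms(2) c(1)]) (use assms(3) c in blast)
qed

section \<open>Symmetric bilinear forms\<close>

locale symmetric_form =
  fixes B :: "'a::euclidean_space \<Rightarrow> 'a \<Rightarrow> real"
  assumes bilinear_form: "bilinear B" and form_commute: "B x y = B y x"
begin

sublocale B: bounded_bilinear B
  using bilinear_form by (simp add: bilinear_conv_bounded_bilinear)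

lemmas B_simps = B.add_left B.add_right B.diff_left B.diff_right B.scaleR_left B.scaleR_right
  B.minus_left B.minus_right B.zero_left B.zero_right

lemma subspace_form_perp: "subspace W \<Longrightarrow> subspace {w \<in> W. B x w = 0}"
  unfolding subspace_def by (auto simp: B_simps)

lemma form_zero_span:
  assumes "\<And>e. e \<in> E \<Longrightarrow> B x e = 0" and "y \<in> span E"
  shows "B x y = 0"
  using assms(2) by (induction rule: span_induct_alt) (auto simp: B_simps assms(1))

lemma form_sum_orthogonal:
  assumes "finite E" and orth: "\<And>x y. x \<in> E \<Longrightarrow> y \<in> E \<Longrightarrow> x \<noteq> y \<Longrightarrow> B x y = 0"
  shows "B (\<Sum>e\<in>E. c e *\<^sub>R e) (\<Sum>e\<in>E. c e *\<^sub>R e) = (\<Sum>e\<in>E. (c e)\<^sup>2 * B e e)"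
proof -
  have "B (\<Sum>e\<in>E. c e *\<^sub>R e) (\<Sum>e\<in>E. c e *\<^sub>R e) = (\<Sum>e\<in>E. \<Sum>f\<in>E. c f * (c e * B f e))"
    by (simp add: B.sum_left B.sum_right B_simps sum_distrib_left mult.left_commute)
  also have "\<dots> = (\<Sum>e\<in>E. \<Sum>f\<in>E. if f = e then c e * (c e * B e e) else 0)"
    by (intro sum.cong refl) (auto simp: orth)
  also have "\<dots> = (\<Sum>e\<in>E. (c e)\<^sup>2 * B e e)"
    using \<open>finite E\<close> by (simp add: power2_eq_square mult.assoc)
  finally show ?thesis .
qed

text \<open>A common vector of the span of the negative vectors of \<open>E\<close> and the span of
  the other vectors of \<open>F\<close> has both a negative definite and a nonnegative square, hence
  is 0. Comparing dimensions inside the common span gives the bound.\<close>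

lemma sylvester_le:
  assumes E: "independent E" "\<And>x y. x \<in> E \<Longrightarrow> y \<in> E \<Longrightarrow> x \<noteq> y \<Longrightarrow> B x y = 0"
    and F: "independent F" "\<And>x y. x \<in> F \<Longrightarrow> y \<in> F \<Longrightarrow> x \<noteq> y \<Longrightarrow> B x y = 0"
    and span: "span E = span F"
  shows "card {e \<in> E. B e e < 0} \<le> card {f \<in> F. B f f < 0}"
proof -
  define En where "En = {e \<in> E. B e e < 0}"
  \<comment> \<open>Null vectors are grouped with the positive ones, so that \<open>Fp\<close> is
    the exact complement of the negative vectors in \<open>F\<close> and the dimensions add up to
    \<open>card F\<close>.\<close>
  define Fp where "Fp = {f \<in> F. \<not> B f f < 0}"
  have fin: "finite E" "finite F" using E(1) F(1) independent_imp_finite by auto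
  have indep: "independent En" "independent Fp"
    by (rule independent_mono[OF E(1)], simp add: En_def, rule independent_mono[OF F(1)], simp add: Fp_def)
  have "x = 0" if x: "x \<in> span En" "x \<in> span Fp" for x
  proof -
    have fin': "finite En" "finite Fp" using fin by (auto simp: En_def Fp_def)
    obtain c where c: "x = (\<Sum>e\<in>En. c e *\<^sub>R e)"
      using x(1) span_finite[OF fin'(1)] by auto
    obtain d where d: "x = (\<Sum>e\<in>Fp. d e *\<^sub>R e)"
      using x(2) span_finite[OF fin'(2)] by auto
    have "B x x = (\<Sum>e\<in>En. (c e)\<^sup>2 * B e e)"
      unfolding c by (rule form_sum_orthogonal[OF fin'(1)]) (use E in \<open>auto simp: En_def\<close>)
    moreover have "B x x = (\<Sum>e\<in>Fp. (d e)\<^sup>2 * B e e)"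
      unfolding d by (rule form_sum_orthogonal[OF fin'(2)]) (use F in \<open>auto simp: Fp_def\<close>)
    moreover have "(\<Sum>e\<in>Fp. (d e)\<^sup>2 * B e e) \<ge> 0"
      by (rule sum_nonneg) (auto simp: Fp_def)
    ultimately have "(\<Sum>e\<in>En. (c e)\<^sup>2 * - B e e) \<le> 0"
      by (simp add: sum_negf)
    moreover have nonneg: "(c e)\<^sup>2 * - B e e \<ge> 0" if "e \<in> En" for e
      using that unfolding En_def mem_Collect_eq by (intro mult_nonneg_nonneg) auto
    ultimately have "(\<Sum>e\<in>En. (c e)\<^sup>2 * - B e e) = 0"
      by (meson order_antisym sum_nonneg)
    then have "\<forall>e\<in>En. (c e)\<^sup>2 * - B e e = 0"
      using sum_nonneg_eq_0_iff[OF fin'(1), of "\<lambda>e. (c e)\<^sup>2 * - B e e"] nonneg by blast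
    then have "\<forall>e\<in>En. c e = 0" by (auto simp: En_def)
    then show "x = 0" unfolding c by simp
  qed
  then have "span En \<inter> span Fp = {0}"
    using span_zero by blast
  then have "dim {x + y |x y. x \<in> span En \<and> y \<in> span Fp} = dim (span En) + dim (span Fp)"
    using dim_sums_Int[OF subspace_span subspace_span, of En Fp] by simp
  also have "\<dots> = card En + card Fp"
    using indep by (simp add: dim_eq_card_independent)
  finally have "card En + card Fp = dim {x + y |x y. x \<in> span En \<and> y \<in> span Fp}" by simp
  also have "\<dots> \<le> dim (span F)"
  proof (rule dim_subset)
    have "span En \<subseteq> span F" "span Fp \<subseteq> span F"
      using span_mono[of En E] span_mono[of Fp F] span by (auto simp: En_def Fp_def)
    then show "{x + y |x y. x \<in> span En \<and> y \<in> span Fp} \<subseteq> span F"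
      by (auto intro: span_add)
  qed
  also have "\<dots> = card F"
    using F(1) by (simp add: dim_eq_card_independent)
  also have "F = {f \<in> F. B f f < 0} \<union> Fp" by (auto simp: Fp_def)
  then have "card F = card {f \<in> F. B f f < 0} + card Fp"
    using card_Un_disjoint[of "{f \<in> F. B f f < 0}" Fp] fin by (auto simp: Fp_def)
  finally show ?thesis by (simp add: En_def)
qed

text \<open>Null vectors are allowed in \<open>E\<close> and \<open>F\<close>, so the form may be degenerate on their span.\<close>

lemma sylvester:
  assumes "independent E" "\<And>x y. x \<in> E \<Longrightarrow> y \<in> E \<Longrightarrow> x \<noteq> y \<Longrightarrow> B x y = 0"
    and "independent F" "\<And>x y. x \<in> F \<Longrightarrow> y \<in> F \<Longrightarrow> x \<noteq> y \<Longrightarrow> B x y = 0"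
    and "span E = span F"
  shows "card {e \<in> E. B e e < 0} = card {f \<in> F. B f f < 0}"
  using sylvester_le[OF assms] sylvester_le[OF assms(3,4,1,2)] assms(5) by force

text \<open>Gram-Schmidt by induction on the dimension, always splitting off a non-null vector; its
  orthogonal complement in \<open>T\<close> is again nondegenerate. If every vector of
  \<open>T\<close> is null, polarisation makes the form vanish on \<open>T\<close>, so
  \<open>T\<close> is trivial.\<close>

lemma orthogonal_basis_exists:
  assumes "subspace T" and "nondegenerate_on B T"
  obtains E where "orthogonal_basis_of B T E"
  using assms
proof (induction "dim T" arbitrary: T thesis rule: less_induct)
  case less
  show ?case
  proof (cases "\<exists>x\<in>T. B x x \<noteq> 0")
    case False
    have "B x y = 0" if "x \<in> T" "y \<in> T" for x y
    proof -
      have "B (x + y) (x + y) = 0" "B x x = 0" "B y y = 0"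
        using False that subspace_add[OF \<open>subspace T\<close>] by auto
      then show ?thesis using form_commute[of x y] by (simp add: B_simps)
    qed
    then have "T = {0}"
      using less.prems(2,3) subspace_0 unfolding nondegenerate_on_def by blast
    then have "orthogonal_basis_of B T {}"
      by (simp add: orthogonal_basis_of_def independent_empty)
    then show ?thesis by (rule less.prems)
  next
    case True
    then obtain x where x: "x \<in> T" "B x x \<noteq> 0" by blast
    define T' where "T' = {w \<in> T. B x w = 0}"
    have sub: "subspace T'" unfolding T'_def by (rule subspace_form_perp) fact
    have dec: "y - (B x y / B x x) *\<^sub>R x \<in> T'" if "y \<in> T" for y
      using that x less.prems(2) by (auto simp: T'_def B_simps subspace_diff subspace_scale)
    have "nondegenerate_on B T'"
      unfolding nondegenerate_on_def
    proof (intro ballI impI)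
      fix w assume w: "w \<in> T'" "\<forall>y\<in>T'. B w y = 0"
      have "B w y = 0" if "y \<in> T" for y
      proof -
        have "B w (y - (B x y / B x x) *\<^sub>R x) = 0" using w dec[OF that] by blast
        moreover have "B w x = 0" using w(1) form_commute by (auto simp: T'_def)
        ultimately show ?thesis by (simp add: B_simps)
      qed
      then show "w = 0" using w(1) less.prems(3) by (auto simp: T'_def nondegenerate_on_def)
    qed
    moreover have "T' \<subset> T" using x by (auto simp: T'_def)
    then have "dim T' < dim T"
      by (metis dim_psubset less.prems(2) span_eq_iff sub)
    ultimately obtain E where E: "orthogonal_basis_of B T' E"
      using less.hyps[OF _ _ sub] by blast
    have "x \<notin> span E" using E x by (auto simp: orthogonal_basis_of_def T'_def)
    moreover have "span (insert x E) = T"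
    proof
      have "E \<subseteq> T'" using E span_superset by (auto simp: orthogonal_basis_of_def)
      then show "span (insert x E) \<subseteq> T"
        using x less.prems(2) by (intro span_minimal) (auto simp: T'_def)
      show "T \<subseteq> span (insert x E)"
        using E dec unfolding orthogonal_basis_of_def span_insert by blast
    qed
    moreover have "B x e = 0" if "e \<in> E" for e
      using E that span_base[OF that] by (auto simp: orthogonal_basis_of_def T'_def)
    ultimately have "orthogonal_basis_of B T (insert x E)"
      using E x form_commute unfolding orthogonal_basis_of_def
      by (auto simp: independent_insert)
    then show ?thesis by (rule less.prems)
  qed
qed

lemma form_projection_eqI:
  assumes "subspace W" and "nondegenerate_on B W" and "w \<in> W" and "\<And>u. u \<in> W \<Longrightarrow> B (v - w) u = 0"
  shows "form_projection B W v = w"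
  unfolding form_projection_def
proof (rule the_equality)
  fix w' assume w': "w' \<in> W \<and> (\<forall>u\<in>W. B (v - w') u = 0)"
  have "\<forall>u\<in>W. B (w' - w) u = 0"
  proof
    fix u assume "u \<in> W"
    then have "B (v - w) u = 0" "B (v - w') u = 0" using assms(4) w' by auto
    then show "B (w' - w) u = 0" by (simp add: B_simps)
  qed
  then show "w' = w"
    using assms(1-3) w' subspace_diff[of W w' w] unfolding nondegenerate_on_def by fastforce
qed (use assms in auto)

lemma smooth_on_open_form:
  "open S \<Longrightarrow> smooth_on_open S f \<Longrightarrow> smooth_on_open S g \<Longrightarrow> smooth_on_open S (\<lambda>x. B (f x) (g x))"
  by (rule smooth_on_open_bilinear[OF _ B.bounded_bilinear_axioms])

end

section \<open>Sections of a quadric by affine spaces\<close>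

lemma induced_metric_eq: "induced_metric B p = B"
  by (simp add: fun_eq_iff induced_metric_def)

text \<open>The form may be degenerate on \<open>W\<close>, in which case \<open>\<epsilon> = 0\<close> and the normal field \<open>n\<close> is null.\<close>

locale quadric_section = symmetric_form B for B :: "'a::euclidean_space \<Rightarrow> 'a \<Rightarrow> real" +
  fixes W Q :: "'a set" and q :: 'a and c \<epsilon> :: real and n :: "'a \<Rightarrow> 'a" and M :: "'a set"
  assumes M_eq: "M = {x. x - q \<in> W \<and> B x x = c \<and> x \<in> Q}"
    and subspace_W: "subspace W" and open_Q: "open Q"
    and smooth_n: "smooth_map_on M n"
    and n_in: "x \<in> M \<Longrightarrow> n x \<in> W"
    and n_transversal: "x \<in> M \<Longrightarrow> B x (n x) = 1"
    and n_norm: "x \<in> M \<Longrightarrow> B (n x) (n x) = \<epsilon>"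
    and n_perp: "x \<in> M \<Longrightarrow> w \<in> W \<Longrightarrow> B x w = 0 \<Longrightarrow> B (n x) w = 0"
    and radical: "x \<in> M \<Longrightarrow> w \<in> W \<Longrightarrow> (\<And>u. u \<in> W \<Longrightarrow> B w u = 0) \<Longrightarrow> B x w = 0 \<Longrightarrow> w = 0"
begin

text \<open>\<open>height u\<close> is the root \<open>s\<close> of \<open>\<epsilon> * s\<^sup>2 + 2 * s + B u u = 0\<close> with \<open>1 + \<epsilon> * s > 0\<close>, in a form
  that covers \<open>\<epsilon> = 0\<close>; near \<open>x\<close> the section is the graph of \<open>height\<close> over its tangent space in
  the direction \<open>n x\<close>.\<close>

definition height :: "'a \<Rightarrow> real" where
  "height u = - B u u / (1 + sqrt (1 - \<epsilon> * B u u))"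

lemma height_equation:
  assumes "1 - \<epsilon> * B u u > 0"
  shows "\<epsilon> * (height u)\<^sup>2 + 2 * height u + B u u = 0"
proof -
  define D where "D = sqrt (1 - \<epsilon> * B u u)"
  have D: "D > 0" "D\<^sup>2 = 1 - \<epsilon> * B u u" using assms by (auto simp: D_def)
  have s: "height u * (1 + D) = - B u u"
    using D(1) by (simp add: height_def D_def [symmetric] field_simps)
  \<comment> \<open>Multiplying by \<open>1 + D\<close> instead of solving for
    \<open>height u\<close> avoids a division by \<open>\<epsilon>\<close>, which may be 0.\<close>
  have "(\<epsilon> * height u - (D - 1)) * (1 + D) = \<epsilon> * (height u * (1 + D)) - (D\<^sup>2 - 1)"
    by (simp add: algebra_simps power2_eq_square)
  also have "\<dots> = 0" by (simp add: s D)
  finally have eq: "\<epsilon> * height u = D - 1" using D by simp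
  have "\<epsilon> * (height u)\<^sup>2 + 2 * height u = height u * (\<epsilon> * height u + 2)"
    by (simp add: algebra_simps power2_eq_square)
  also have "\<dots> = height u * (1 + D)" unfolding eq by simp
  finally have "\<epsilon> * (height u)\<^sup>2 + 2 * height u = height u * (1 + D)" .
  then show ?thesis using s by simp
qed

text \<open>Completing the square gives \<open>(1 + \<epsilon> * s)\<^sup>2 = D\<^sup>2\<close>, the
  sign condition selects the root \<open>D\<close>, and then \<open>s * (1 + D) = - B u u\<close>
  determines \<open>s\<close> also for \<open>\<epsilon> = 0\<close>.\<close>

lemma height_unique:
  assumes "1 - \<epsilon> * B u u > 0" and "1 + \<epsilon> * s > 0" and "\<epsilon> * s\<^sup>2 + 2 * s + B u u = 0"
  shows "s = height u"
proof -
  define D where "D = sqrt (1 - \<epsilon> * B u u)"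
  have "(1 + \<epsilon> * s)\<^sup>2 = 1 + \<epsilon> * (\<epsilon> * s\<^sup>2 + 2 * s + B u u) - \<epsilon> * B u u"
    by (simp add: algebra_simps power2_eq_square)
  also have "\<dots> = 1 - \<epsilon> * B u u" using assms(3) by simp
  finally have "1 + \<epsilon> * s = D"
    using assms(2) by (metis D_def abs_of_pos real_sqrt_abs)
  moreover have "s * (2 + \<epsilon> * s) = - B u u"
    using assms(3) by (simp add: algebra_simps power2_eq_square)
  ultimately have "s * (1 + D) = - B u u" by (metis add.assoc one_add_one)
  moreover have "D > 0" using assms(1) by (simp add: D_def)
  ultimately show ?thesis by (simp add: height_def D_def [symmetric] field_simps)
qed

lemma smooth_height:
  assumes "open S" and "smooth_on_open S f" and "\<And>y. y \<in> S \<Longrightarrow> 1 - \<epsilon> * B (f y) (f y) > 0"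
  shows "smooth_on_open S (\<lambda>y. height (f y))"
  unfolding height_def
proof (intro smooth_on_open_divide smooth_on_open_minus smooth_on_open_add smooth_on_open_sqrt
    smooth_on_open_diff smooth_on_open_mult smooth_on_open_form smooth_on_open_const assms)
  fix y assume "y \<in> S"
  then have "sqrt (1 - \<epsilon> * B (f y) (f y)) > 0" using assms(3) by simp
  then show "1 + sqrt (1 - \<epsilon> * B (f y) (f y)) \<noteq> 0" by linarith
qed

text \<open>\<open>u\<close> is orthogonal to \<open>x\<close> and therefore to \<open>n x\<close>,
  so all mixed terms with \<open>u\<close> vanish. Lying on the quadric becomes a scalar equation in
  \<open>s\<close> whose coefficients depend on \<open>u\<close> only through \<open>B u u\<close>
  and on \<open>x\<close> not at all.\<close>

lemma form_parametrisation:
  assumes "x \<in> M" and "u \<in> W" and "B x u = 0"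
  shows "B (x + s *\<^sub>R n x + u) (x + s *\<^sub>R n x + u) = c + (\<epsilon> * s\<^sup>2 + 2 * s + B u u)"
proof -
  have "B x x = c" using assms M_eq by simp
  then show ?thesis
    using n_transversal[OF assms(1)] n_norm[OF assms(1)] n_perp[OF assms] assms(3)
      form_commute[of u x] form_commute[of u "n x"] form_commute[of "n x" x]
    by (simp add: B_simps algebra_simps power2_eq_square)
qed

lemma M_diff: "x \<in> M \<Longrightarrow> y \<in> M \<Longrightarrow> y - x \<in> W"
  using subspace_diff[OF subspace_W, of "y - q" "x - q"] by (simp add: M_eq)

lemma graph_in_M:
  assumes "x \<in> M" and "u \<in> W" and "B x u = 0" and "1 - \<epsilon> * B u u > 0"
    and "x + height u *\<^sub>R n x + u \<in> Q"
  shows "x + height u *\<^sub>R n x + u \<in> M"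
proof -
  have "(x - q) + (height u *\<^sub>R n x + u) \<in> W"
    using assms n_in subspace_W by (intro subspace_add subspace_scale) (auto simp: M_eq)
  then have "x + height u *\<^sub>R n x + u - q \<in> W" by (simp add: algebra_simps)
  then show ?thesis
    using form_parametrisation[OF assms(1-3)] height_equation[OF assms(4)] assms(5) by (simp add: M_eq)
qed

lemma tangent_space_eq:
  assumes x: "x \<in> M"
  shows "tangent_space M x = {w \<in> W. B x w = 0}"
proof (intro equalityI subsetI)
  fix v assume v: "v \<in> tangent_space M x"
  have "v \<in> W"
    using tangent_space_subset_subspace[OF v subspace_W] M_diff[OF x] by blast
  moreover obtain \<gamma> where \<gamma>: "curve_through M x v \<gamma>"
    using v unfolding tangent_space_def by blast
  have "((\<lambda>y. B y y) has_derivative (\<lambda>h. B x h + B h x)) (at x)"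
    by (rule B.FDERIV) (rule has_derivative_ident)+
  \<comment> \<open>On \<open>M\<close> the constant \<open>c\<close> has the extension
    \<open>B y y\<close>; comparing both derivatives along the curve yields orthogonality to
    \<open>x\<close>.\<close>
  then have "((\<lambda>y. c) \<circ> \<gamma> has_vector_derivative B x v + B v x) (at 0)"
    by (rule curve_through_compose[OF \<gamma> open_UNIV UNIV_I]) (simp add: M_eq)
  then have "B x v + B v x = 0"
    unfolding comp_def by (rule vector_derivative_unique_at[OF _ has_vector_derivative_const])
  then have "B x v = 0" using form_commute[of x v] by simp
  ultimately show "v \<in> {w \<in> W. B x w = 0}" by simp
next
  fix w assume "w \<in> {w \<in> W. B x w = 0}"
  then have w: "w \<in> W" "B x w = 0" by auto
  define I where "I = {t::real. 1 - \<epsilon> * B (t *\<^sub>R w) (t *\<^sub>R w) > 0}"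
  define \<gamma> where "\<gamma> t = x + height (t *\<^sub>R w) *\<^sub>R n x + t *\<^sub>R w" for t
  have "open I"
    unfolding I_def by (intro open_Collect_less continuous_intros B.continuous_on)
  have smooth_id: "smooth_on_open I (\<lambda>t. t *\<^sub>R w)"
    using \<open>open I\<close> by (intro smooth_intros)
  have smooth: "smooth_on_open I \<gamma>"
    unfolding \<gamma>_def using \<open>open I\<close>
    by (intro smooth_on_open_add smooth_on_open_scaleR smooth_on_open_const smooth_height smooth_on_open_id)
      (auto simp: I_def)
  have "open (I \<inter> \<gamma> -` Q)"
    by (rule continuous_open_preimage[OF smooth_on_open_continuous_on[OF smooth] \<open>open I\<close> open_Q])
  moreover have "0 \<in> I \<inter> \<gamma> -` Q"
    using x by (simp add: I_def \<gamma>_def height_def B_simps M_eq)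
  ultimately obtain e where e: "e > 0" "ball 0 e \<subseteq> I \<inter> \<gamma> -` Q"
    using open_contains_ball by blast
  have ball: "ball 0 e = {-e<..<e}" by (auto simp: dist_real_def)
  have "\<gamma> t \<in> M" if "t \<in> {-e<..<e}" for t
  proof -
    have "t \<in> I" "\<gamma> t \<in> Q" using that e(2) unfolding ball by auto
    then show ?thesis
      unfolding \<gamma>_def I_def
      by (intro graph_in_M x subspace_scale[OF subspace_W]) (simp_all add: w B_simps)
  qed
  moreover have "smooth_on_open {-e<..<e} \<gamma>"
    by (rule smooth_on_open_subset[OF smooth]) (use e(2) ball in auto)
  moreover have "\<gamma> 0 = x" by (simp add: \<gamma>_def height_def B_simps)
  moreover have "(\<gamma> has_vector_derivative w) (at 0)"
  proof -
    \<comment> \<open>\<open>height (t *\<^sub>R w)\<close> is of second order in \<open>t\<close>,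
      so lifting the line to the quadric does not change its velocity.\<close>
    have "((\<lambda>t. height (t *\<^sub>R w)) has_real_derivative 0) (at 0)"
      unfolding height_def B_simps by (auto intro!: derivative_eq_intros)
    then show ?thesis
      unfolding \<gamma>_def by (auto intro!: derivative_eq_intros)
  qed
  ultimately show "w \<in> tangent_space M x"
    unfolding tangent_space_def curve_through_def using e(1) by blast
qed

lemma subspace_tangent: "subspace {w \<in> W. B x w = 0}"
  by (rule subspace_form_perp[OF subspace_W])

lemma tangent_decomposition:
  assumes "x \<in> M" and "w \<in> W"
  shows "w - B x w *\<^sub>R n x \<in> {w \<in> W. B x w = 0}"
  using assms n_in n_transversal subspace_W by (simp add: B_simps subspace_diff subspace_scale)

text \<open>\<open>W\<close> is the tangent space plus the line of \<open>n x\<close>, and tangent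
  vectors are orthogonal to \<open>n x\<close>. A tangent vector orthogonal to all tangent vectors
  is thus orthogonal to all of \<open>W\<close>, and \<open>radical\<close> applies.\<close>

lemma nondegenerate_tangent:
  assumes "x \<in> M"
  shows "nondegenerate_on B {w \<in> W. B x w = 0}"
  unfolding nondegenerate_on_def
proof (intro ballI impI)
  fix w assume w: "w \<in> {w \<in> W. B x w = 0}" "\<forall>y\<in>{w \<in> W. B x w = 0}. B w y = 0"
  have "B w u = 0" if "u \<in> W" for u
  proof -
    have "B w (u - B x u *\<^sub>R n x) = 0"
      using w(2) tangent_decomposition[OF assms that] by blast
    moreover have "B w (n x) = 0"
      using n_perp[OF assms] w(1) form_commute[of w "n x"] by simp
    ultimately show ?thesis by (simp add: B_simps)
  qed
  then show "w = 0" using radical[OF assms] w(1) by blast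
qed

lemma span_insert_transversal:
  assumes "x \<in> M" and "span E = {w \<in> W. B x w = 0}"
  shows "span (insert (n x) E) = W" and "n x \<notin> span E"
proof
  have "E \<subseteq> W" using assms(2) span_superset[of E] by auto
  then show "span (insert (n x) E) \<subseteq> W"
    using n_in[OF assms(1)] subspace_W by (intro span_minimal) auto
  show "W \<subseteq> span (insert (n x) E)"
    using tangent_decomposition[OF assms(1)] assms(2) unfolding span_insert by blast
  show "n x \<notin> span E" using assms n_transversal by simp
qed

lemma dim_tangent:
  assumes "x \<in> M"
  shows "dim {w \<in> W. B x w = 0} = dim W - 1"
proof -
  have "span {w \<in> W. B x w = 0} = {w \<in> W. B x w = 0}"
    using subspace_tangent by (simp add: span_eq_iff)
  from span_insert_transversal[OF assms this] show ?thesis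
    by (metis dim_insert dim_span diff_add_inverse2)
qed

text \<open>The chart \<open>h\<close> translates \<open>x\<close> to 0 and shears along
  \<open>n x\<close>, flattening the graph of \<open>height\<close>. The shear preserves
  \<open>u y\<close>, the part of \<open>y - x\<close> in the kernel of \<open>B x\<close>, so the
  same height can be added back: this is the inverse \<open>h'\<close>.\<close>

lemma submanifold_M: "submanifold M"
  unfolding submanifold_def
proof (rule exI[of _ "dim W - 1"], rule ballI)
  fix x assume x: "x \<in> M"
  define s where "s y = B x (y - x)" for y
  define u where "u y = (y - x) - s y *\<^sub>R n x" for y
  define G where "G = {z. 1 - \<epsilon> * B z z > 0}"
  define v where "v z = z - B x z *\<^sub>R n x" for z
  define h where "h y = y - x - height (u y) *\<^sub>R n x" for y
  define h' where "h' z = z + x + height (v z) *\<^sub>R n x" for z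
  \<comment> \<open>A line in direction \<open>n x\<close> can meet the quadric twice if
    \<open>\<epsilon>\<close> is nonzero; \<open>1 + \<epsilon> * s y > 0\<close> keeps the sheet
    described by \<open>height\<close>.\<close>
  define U where "U = {y. u y \<in> G \<and> 1 + \<epsilon> * s y > 0 \<and> y \<in> Q}"
  define G' where "G' = {z. v z \<in> G}"
  define U' where "U' = G' \<inter> h' -` {y. 1 + \<epsilon> * s y > 0 \<and> y \<in> Q}"
  have Bxn: "B x (n x) = 1" using n_transversal[OF x] .
  have open1: "open {y. 1 + \<epsilon> * s y > 0 \<and> y \<in> Q}"
    unfolding s_def using open_Q
    by (intro open_Collect_conj open_Collect_less continuous_intros B.continuous_on) auto
  have "open {y. u y \<in> G}"
    unfolding u_def s_def G_def mem_Collect_eq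
    by (intro open_Collect_less continuous_intros B.continuous_on)
  then have "open ({y. u y \<in> G} \<inter> {y. 1 + \<epsilon> * s y > 0 \<and> y \<in> Q})"
    using open1 by (rule open_Int)
  moreover have "U = {y. u y \<in> G} \<inter> {y. 1 + \<epsilon> * s y > 0 \<and> y \<in> Q}"
    by (auto simp: U_def)
  ultimately have "open U" by simp
  have "open G'"
    unfolding G'_def v_def G_def mem_Collect_eq
    by (intro open_Collect_less continuous_intros B.continuous_on)
  have smooth_h': "smooth_on_open G' h'"
    unfolding h'_def using \<open>open G'\<close>
    by (intro smooth_on_open_add smooth_on_open_id smooth_on_open_const smooth_on_open_scaleR smooth_height)
      (auto simp: G'_def G_def v_def intro!: smooth_on_open_diff smooth_on_open_id
        smooth_on_open_scaleR smooth_on_open_form smooth_on_open_const)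
  have "open U'"
    unfolding U'_def
    by (rule continuous_open_preimage[OF smooth_on_open_continuous_on[OF smooth_h'] \<open>open G'\<close> open1])
  have smooth_h: "smooth_on_open U h"
    unfolding h_def using \<open>open U\<close>
    by (intro smooth_on_open_diff smooth_on_open_id smooth_on_open_const smooth_on_open_scaleR smooth_height)
      (auto simp: U_def G_def u_def s_def intro!: smooth_on_open_diff smooth_on_open_id
        smooth_on_open_scaleR smooth_on_open_form smooth_on_open_const)
  have smooth_h'_U': "smooth_on_open U' h'"
    by (rule smooth_on_open_subset[OF smooth_h']) (auto simp: U'_def)
  have v_h: "v (h y) = u y" for y
    by (simp add: v_def h_def u_def s_def B_simps Bxn algebra_simps)
  have u_h': "u (h' z) = v z" for z
    by (simp add: v_def h'_def u_def s_def B_simps Bxn algebra_simps)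
  have h'_h: "h' (h y) = y" for y
    unfolding h'_def v_h by (simp add: h_def)
  have h_h': "h (h' z) = z" for z
    unfolding h_def u_h' by (simp add: h'_def)
  have maps: "h y \<in> U'" if "y \<in> U" for y
    using that by (simp add: U'_def G'_def v_h h'_h U_def)
  have maps': "h' z \<in> U" if "z \<in> U'" for z
    using that by (simp add: U'_def G'_def u_h' U_def)
  have "homeomorphism U U' h h'"
    using maps maps' smooth_on_open_continuous_on[OF smooth_h] smooth_on_open_continuous_on[OF smooth_h'_U']
    by (intro homeomorphismI) (auto simp: h'_h h_h')
  moreover have "x \<in> U"
    using x by (simp add: U_def u_def s_def G_def B_simps M_eq)
  moreover have "h ` (M \<inter> U) = {w \<in> W. B x w = 0} \<inter> U'"
  proof (intro equalityI subsetI)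
    fix z assume "z \<in> h ` (M \<inter> U)"
    then obtain y where y: "y \<in> M" "y \<in> U" "z = h y" by blast
    have uy: "u y \<in> W" "B x (u y) = 0"
      using M_diff[OF x y(1)] n_in[OF x] subspace_W
      by (auto simp: u_def s_def B_simps Bxn subspace_diff subspace_scale)
    have "y = x + s y *\<^sub>R n x + u y" by (simp add: u_def)
    then have "B y y = c + (\<epsilon> * (s y)\<^sup>2 + 2 * s y + B (u y) (u y))"
      using form_parametrisation[OF x uy] by metis
    then have "s y = height (u y)"
      using y by (intro height_unique) (auto simp: U_def G_def M_eq)
    then have "h y = u y" by (simp add: h_def u_def)
    then show "z \<in> {w \<in> W. B x w = 0} \<inter> U'" using uy y(3) maps[OF y(2)] by simp
  next
    fix z assume z: "z \<in> {w \<in> W. B x w = 0} \<inter> U'"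
    then have vz: "v z = z" by (simp add: v_def)
    then have h'z: "h' z = x + height z *\<^sub>R n x + z" by (simp add: h'_def)
    have "h' z \<in> M"
      using z vz unfolding h'z by (intro graph_in_M x) (auto simp: U'_def G'_def G_def h'z)
    then have "h (h' z) \<in> h ` (M \<inter> U)" using z maps' by blast
    then show "z \<in> h ` (M \<inter> U)" by (simp add: h_h')
  qed
  ultimately have "open U \<and> x \<in> U \<and> open U' \<and> homeomorphism U U' h h' \<and>
      smooth_on_open U h \<and> smooth_on_open U' h' \<and> subspace {w \<in> W. B x w = 0} \<and>
      dim {w \<in> W. B x w = 0} = dim W - 1 \<and> h ` (M \<inter> U) = {w \<in> W. B x w = 0} \<inter> U'"
    using \<open>open U\<close> \<open>open U'\<close> smooth_h smooth_h'_U' subspace_tangent dim_tangent[OF x]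
    by (intro conjI)
  then show "\<exists>U U' (h::'a \<Rightarrow> 'a) h' Wx. open U \<and> x \<in> U \<and> open U' \<and> homeomorphism U U' h h' \<and>
      smooth_on_open U h \<and> smooth_on_open U' h' \<and> subspace Wx \<and> dim Wx = dim W - 1 \<and>
      h ` (M \<inter> U) = Wx \<inter> U'"
    by (intro exI)
qed

text \<open>After adjoining \<open>n x\<close>, the bases at all points are orthogonal bases of the
  same space \<open>W\<close>. The added vector has square \<open>\<epsilon>\<close>, so it changes
  the number of negative vectors by an amount independent of \<open>x\<close>; for
  \<open>\<epsilon> = 0\<close> it is null, which is why \<open>sylvester\<close> admits null
  vectors.\<close>

lemma index_constant:
  "\<exists>\<nu>. \<forall>x\<in>M. has_index B {w \<in> W. B x w = 0} \<nu>"
proof -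
  have "\<exists>E. orthogonal_basis_of B {w \<in> W. B x w = 0} E" if "x \<in> M" for x
    using orthogonal_basis_exists[OF subspace_tangent nondegenerate_tangent[OF that]] by blast
  then obtain E where E: "\<And>x. x \<in> M \<Longrightarrow> orthogonal_basis_of B {w \<in> W. B x w = 0} (E x)"
    by metis
  let ?neg = "\<lambda>F. card {f \<in> F. B f f < 0}"
  have basis: "independent (insert (n x) (E x))" "span (insert (n x) (E x)) = W"
    "\<forall>e\<in>insert (n x) (E x). \<forall>f\<in>insert (n x) (E x). e \<noteq> f \<longrightarrow> B e f = 0"
    "?neg (insert (n x) (E x)) = ?neg (E x) + (if \<epsilon> < 0 then 1 else 0)"
    if x: "x \<in> M" for x
  proof -
    note Ex = E[OF x, unfolded orthogonal_basis_of_def]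
    have span: "span (E x) = {w \<in> W. B x w = 0}" using Ex by blast
    note ins = span_insert_transversal[OF x span]
    show "independent (insert (n x) (E x))" using Ex ins(2) by (simp add: independent_insert)
    show "span (insert (n x) (E x)) = W" by (rule ins(1))
    have "B (n x) e = 0" if "e \<in> E x" for e
      using n_perp[OF x] span_base[OF that] span by blast
    then show "\<forall>e\<in>insert (n x) (E x). \<forall>f\<in>insert (n x) (E x). e \<noteq> f \<longrightarrow> B e f = 0"
      using Ex form_commute by auto
    have "finite (E x)" using Ex independent_imp_finite by blast
    moreover have "n x \<notin> E x" using ins(2) span_base by blast
    moreover have "{f \<in> insert (n x) (E x). B f f < 0} =
        (if \<epsilon> < 0 then insert (n x) {f \<in> E x. B f f < 0} else {f \<in> E x. B f f < 0})"
      using n_norm[OF x] by auto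
    ultimately show "?neg (insert (n x) (E x)) = ?neg (E x) + (if \<epsilon> < 0 then 1 else 0)"
      by simp
  qed
  have "?neg (E x) = ?neg (E y)" if "x \<in> M" "y \<in> M" for x y
  proof -
    have "?neg (insert (n x) (E x)) = ?neg (insert (n y) (E y))"
      using basis(1,2,3)[OF that(1)] basis(1,2,3)[OF that(2)] by (intro sylvester) auto
    then show ?thesis using basis(4) that by simp
  qed
  then show ?thesis unfolding has_index_def using E by blast
qed

lemma pseudo_riemannian_M: "pseudo_riemannian M (induced_metric B)"
  unfolding pseudo_riemannian_def induced_metric_eq
proof (intro conjI allI impI ballI)
  show "submanifold M" by (rule submanifold_M)
  show "\<exists>\<nu>. \<forall>p\<in>M. nondegenerate_on B (tangent_space M p) \<and> has_index B (tangent_space M p) \<nu>"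
    using index_constant nondegenerate_tangent by (simp add: tangent_space_eq)
  fix X Y assume "tangent_field M X \<and> tangent_field M Y"
  then show "smooth_map_on M (\<lambda>p. B (X p) (Y p))"
    unfolding tangent_field_def by (auto intro: smooth_map_on_bilinear[OF B.bounded_bilinear_axioms])
qed (simp_all add: B_simps form_commute)

text \<open>Differentiating \<open>B x (Y x) = 0\<close> along \<open>M\<close> shows that the \<open>n x\<close>-component of the
  derivative of a tangent field \<open>Y\<close> in the direction \<open>v\<close> is \<open>- B v (Y x)\<close>.\<close>

lemma second_fundamental_form_eq:
  assumes x: "x \<in> M" and \<kappa>: "\<kappa> \<noteq> 0" "c = 1 / \<kappa>"
    and TQ: "tangent_space (hyperquadric B \<kappa>) x = {w. B x w = 0}"
    and nd: "nondegenerate_on B {w. B x w = 0}"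
    and v: "v \<in> W" "B x v = 0" and w: "w \<in> W" "B x w = 0"
  shows "second_fundamental_form B (hyperquadric B \<kappa>) M x v w = B v w *\<^sub>R (\<kappa> *\<^sub>R x - n x)"
proof -
  let ?T = "{w \<in> W. B x w = 0}"
  have Bxx: "B x x = c" using x M_eq by simp
  have vT: "v \<in> tangent_space M x" using v by (simp add: tangent_space_eq[OF x])
  have main: "covariant_derivative B (hyperquadric B \<kappa>) M Y x v -
      form_projection B (tangent_space M x) (covariant_derivative B (hyperquadric B \<kappa>) M Y x v)
      = B v w *\<^sub>R (\<kappa> *\<^sub>R x - n x)"
    if Y: "tangent_field M Y" "Y x = w" for Y
  proof -
    obtain U F where F: "open U" "x \<in> U" "smooth_on_open U F" "\<And>y. y \<in> M \<inter> U \<Longrightarrow> F y = Y y"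
      using Y(1) x unfolding tangent_field_def smooth_map_on_def by metis
    have dF: "(F has_derivative frechet_derivative F (at x)) (at x)"
      by (rule smooth_on_open_has_derivative[OF F(3,2)])
    define d where "d = frechet_derivative F (at x) v"
    have diff: "differential M Y x v = d"
      unfolding d_def by (rule differential_eqI[OF vT F(1,2) dF F(4)])
    have YW: "Y y \<in> W \<and> B y (Y y) = 0" if "y \<in> M" for y
      using Y(1) that tangent_space_eq[OF that] unfolding tangent_field_def by blast
    obtain \<gamma> where \<gamma>: "curve_through M x v \<gamma>"
      using vT unfolding tangent_space_def by blast
    have "((\<lambda>y. B y (F y)) has_derivative
        (\<lambda>h. B x (frechet_derivative F (at x) h) + B h (F x))) (at x)"
      by (rule B.FDERIV[OF has_derivative_ident dF])
    then have "((\<lambda>y. 0) \<circ> \<gamma> has_vector_derivative B x d + B v (F x)) (at 0)"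
      unfolding d_def by (rule curve_through_compose[OF \<gamma> F(1,2)]) (use YW F(4) in auto)
    then have "B x d + B v (F x) = 0"
      unfolding comp_def by (rule vector_derivative_unique_at[OF _ has_vector_derivative_const])
    then have Bxd: "B x d = - B v w" using F(2,4) x Y(2) by simp
    have "d \<in> W"
    proof -
      have dY: "(Y \<circ> \<gamma> has_vector_derivative d) (at 0)"
        unfolding d_def by (rule curve_through_compose[OF \<gamma> F(1,2) dF F(4)])
      obtain e where e: "e > 0" "\<gamma> ` {-e<..<e} \<subseteq> M"
        using \<gamma> unfolding curve_through_def by blast
      have "(Y \<circ> \<gamma>) t \<in> W" if "t \<in> {-e<..<e}" for t
        using YW[of "\<gamma> t"] subsetD[OF e(2) imageI[OF that]] by simp
      then show ?thesis
        using e(1) by (intro vector_derivative_in_subspace[OF dY subspace_W e(1)] subspace_diff[OF subspace_W]) auto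
    qed
    \<comment> \<open>The component of \<open>d\<close> along \<open>x\<close> is removed: its
      coefficient is \<open>\<kappa> * B x d\<close>, and \<open>B x d = - B v w\<close>.\<close>
    let ?D = "d + (\<kappa> * B v w) *\<^sub>R x"
    have cov: "covariant_derivative B (hyperquadric B \<kappa>) M Y x v = ?D"
      unfolding covariant_derivative_def TQ diff
    proof (rule form_projection_eqI[OF _ nd])
      show "subspace {w. B x w = 0}" using subspace_form_perp[OF subspace_UNIV] by simp
      show "?D \<in> {w. B x w = 0}" using Bxd Bxx \<kappa> by (simp add: B_simps)
    qed (simp add: B_simps)
    \<comment> \<open>Since \<open>d\<close> lies in \<open>W\<close>, subtracting
      \<open>B x d *\<^sub>R n x\<close> makes it tangent to \<open>M\<close>; the difference to
      \<open>?D\<close> is a combination of \<open>x\<close> and \<open>n x\<close>, both orthogonal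
      to the tangent space.\<close>
    have "form_projection B (tangent_space M x) ?D = d + B v w *\<^sub>R n x"
      unfolding tangent_space_eq[OF x]
    proof (rule form_projection_eqI[OF subspace_tangent nondegenerate_tangent[OF x]])
      show "d + B v w *\<^sub>R n x \<in> ?T"
        using tangent_decomposition[OF x \<open>d \<in> W\<close>] Bxd by simp
    qed (use n_perp[OF x] in \<open>simp add: B_simps\<close>)
    then show ?thesis unfolding cov by (simp add: algebra_simps)
  qed
  \<comment> \<open>The constant field \<open>w\<close> is made tangent by projecting along
    \<open>n\<close>; some tangent extension of \<open>w\<close> must exist for the definite
    description to denote.\<close>
  define Y where "Y y = w - B y w *\<^sub>R n y" for y
  have "smooth_map_on M Y"
    unfolding smooth_map_on_def
  proof
    fix p assume "p \<in> M"
    then obtain U F where F: "open U" "p \<in> U" "smooth_on_open U F" "\<forall>x\<in>M \<inter> U. F x = n x"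
      using smooth_n unfolding smooth_map_on_def by metis
    have "smooth_on_open U (\<lambda>y. w - B y w *\<^sub>R F y)"
      using F by (intro smooth_intros smooth_on_open_form)
    then show "\<exists>U F. open U \<and> p \<in> U \<and> smooth_on_open U F \<and> (\<forall>x\<in>M \<inter> U. F x = Y x)"
      using F unfolding Y_def by (intro exI[of _ U] exI[of _ "\<lambda>y. w - B y w *\<^sub>R F y"]) auto
  qed
  moreover have "Y y \<in> tangent_space M y" if "y \<in> M" for y
    using tangent_decomposition[OF that w(1)] by (simp add: tangent_space_eq[OF that] Y_def)
  ultimately have Y: "tangent_field M Y" "Y x = w"
    using w by (auto simp: tangent_field_def Y_def)
  show ?thesis
    unfolding second_fundamental_form_def
  proof (rule the_equality)
    show "\<exists>Y. tangent_field M Y \<and> Y x = w \<and> B v w *\<^sub>R (\<kappa> *\<^sub>R x - n x) =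
        covariant_derivative B (hyperquadric B \<kappa>) M Y x v -
        form_projection B (tangent_space M x) (covariant_derivative B (hyperquadric B \<kappa>) M Y x v)"
      using Y main[OF Y] by (intro exI[of _ Y]) simp
  qed (use main in auto)
qed

text \<open>By umbilicity the factor \<open>B e e\<close> cancels the weight
  \<open>1 / B e e\<close>, so every basis vector contributes the same vector and the average does
  not depend on the basis.\<close>

lemma mean_curvature_vector_eq:
  assumes x: "x \<in> M" and \<kappa>: "\<kappa> \<noteq> 0" "c = 1 / \<kappa>"
    and TQ: "tangent_space (hyperquadric B \<kappa>) x = {w. B x w = 0}"
    and nd: "nondegenerate_on B {w. B x w = 0}"
    and nontrivial: "{w \<in> W. B x w = 0} \<noteq> {0}"
  shows "mean_curvature_vector B (hyperquadric B \<kappa>) M x = \<kappa> *\<^sub>R x - n x"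
proof -
  have main: "(1 / real (card E)) *\<^sub>R
      (\<Sum>e\<in>E. (1 / B e e) *\<^sub>R second_fundamental_form B (hyperquadric B \<kappa>) M x e e) = \<kappa> *\<^sub>R x - n x"
    if E: "orthogonal_basis_of B {w \<in> W. B x w = 0} E" for E
  proof -
    have fin: "finite E" and span: "span E = {w \<in> W. B x w = 0}"
      using E independent_imp_finite by (auto simp: orthogonal_basis_of_def)
    have "E \<noteq> {}"
    proof
      assume "E = {}"
      then show False using span nontrivial span_empty by simp
    qed
    have "(\<Sum>e\<in>E. (1 / B e e) *\<^sub>R second_fundamental_form B (hyperquadric B \<kappa>) M x e e)
        = (\<Sum>e\<in>E. \<kappa> *\<^sub>R x - n x)"
    proof (rule sum.cong[OF refl])
      fix e assume e: "e \<in> E"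
      then have "e \<in> W" "B x e = 0" using span span_base[of e E] by auto
      moreover have "B e e \<noteq> 0" using E e by (simp add: orthogonal_basis_of_def)
      ultimately show "(1 / B e e) *\<^sub>R second_fundamental_form B (hyperquadric B \<kappa>) M x e e = \<kappa> *\<^sub>R x - n x"
        using second_fundamental_form_eq[OF x \<kappa> TQ nd] by simp
    qed
    also have "\<dots> = real (card E) *\<^sub>R (\<kappa> *\<^sub>R x - n x)"
      by (simp add: sum_constant_scaleR)
    finally show ?thesis using fin \<open>E \<noteq> {}\<close> by simp
  qed
  obtain E where E: "orthogonal_basis_of B {w \<in> W. B x w = 0} E"
    using orthogonal_basis_exists[OF subspace_tangent nondegenerate_tangent[OF x]] .
  show ?thesis
    unfolding mean_curvature_vector_def tangent_space_eq[OF x]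
  proof (rule the_equality)
    show "\<exists>E. orthogonal_basis_of B {w \<in> W. B x w = 0} E \<and>
        \<kappa> *\<^sub>R x - n x = (1 / real (card E)) *\<^sub>R
          (\<Sum>e\<in>E. (1 / B e e) *\<^sub>R second_fundamental_form B (hyperquadric B \<kappa>) M x e e)"
      using E main[OF E] by (intro exI[of _ E]) simp
  qed (use main in auto)
qed

end

section \<open>The decomposition of the hyperquadric\<close>

context symmetric_form
begin

lemma form_projection:
  assumes "subspace W" and "nondegenerate_on B W"
  shows form_projection_in: "form_projection B W x \<in> W"
    and form_projection_perp: "u \<in> W \<Longrightarrow> B (x - form_projection B W x) u = 0"
proof -
  obtain E where E: "orthogonal_basis_of B W E"
    using orthogonal_basis_exists[OF assms] .
  have fin: "finite E" and span: "span E = W" and orth: "\<And>e f. e \<in> E \<Longrightarrow> f \<in> E \<Longrightarrow> e \<noteq> f \<Longrightarrow> B e f = 0"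
    and nonnull: "\<And>e. e \<in> E \<Longrightarrow> B e e \<noteq> 0"
    using E independent_imp_finite by (auto simp: orthogonal_basis_of_def)
  define w where "w = (\<Sum>e\<in>E. (B x e / B e e) *\<^sub>R e)"
  have w: "w \<in> W"
    unfolding w_def span[symmetric] by (intro span_sum span_scale span_base)
  have "B (x - w) f = 0" if f: "f \<in> E" for f
  proof -
    have "B w f = (\<Sum>e\<in>E. if e = f then B x f else 0)"
      unfolding w_def B.sum_left by (rule sum.cong[OF refl]) (use f orth nonnull in \<open>auto simp: B_simps\<close>)
    then show ?thesis using fin f by (simp add: B_simps)
  qed
  then have perp: "B (x - w) u = 0" if "u \<in> W" for u
    using form_zero_span[of E "x - w" u] that span by blast
  then have "form_projection B W x = w"
    by (intro form_projection_eqI assms w)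
  then show "form_projection B W x \<in> W" and "u \<in> W \<Longrightarrow> B (x - form_projection B W x) u = 0"
    using w perp by auto
qed

lemma bounded_linear_form_projection:
  assumes "subspace W" and "nondegenerate_on B W"
  shows "bounded_linear (form_projection B W)"
proof -
  note p = form_projection_in[OF assms] form_projection_perp[OF assms]
  have "linear (form_projection B W)"
  proof (rule linearI)
    fix x y :: 'a and r :: real
    show "form_projection B W (x + y) = form_projection B W x + form_projection B W y"
    proof (rule form_projection_eqI[OF assms])
      fix u assume "u \<in> W"
      then have "B (x - form_projection B W x) u = 0" "B (y - form_projection B W y) u = 0"
        by (auto intro: p)
      then show "B (x + y - (form_projection B W x + form_projection B W y)) u = 0"
        by (simp add: B_simps)
    qed (intro subspace_add assms p)
    show "form_projection B W (r *\<^sub>R x) = r *\<^sub>R form_projection B W x"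
    proof (rule form_projection_eqI[OF assms])
      fix u assume "u \<in> W"
      then have "B (x - form_projection B W x) u = 0" by (rule p)
      then show "B (r *\<^sub>R x - r *\<^sub>R form_projection B W x) u = 0"
        by (simp add: B_simps)
    qed (intro subspace_scale assms p)
  qed
  then show ?thesis by (simp add: linear_conv_bounded_linear)
qed

text \<open>For a linear \<open>W\<close> the position vector is normal to the section; the factor
  \<open>\<kappa>\<close> normalises \<open>B x (n x)\<close> to 1, and then
  \<open>B (n x) (n x) = \<kappa>\<close>. This serves both the hyperquadric and the base.\<close>

lemma quadric_section_nondegenerate:
  assumes "subspace W" and "nondegenerate_on B W" and "open Q" and "\<kappa> \<noteq> 0"
  shows "quadric_section B W Q 0 (1 / \<kappa>) \<kappa> (\<lambda>x. \<kappa> *\<^sub>R x) {x \<in> W. B x x = 1 / \<kappa> \<and> x \<in> Q}"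
proof unfold_locales
  show "smooth_map_on {x \<in> W. B x x = 1 / \<kappa> \<and> x \<in> Q} (\<lambda>x. \<kappa> *\<^sub>R x)"
    by (rule smooth_map_onI[OF open_UNIV _ smooth_on_open_scaleR[OF open_UNIV smooth_on_open_const smooth_on_open_id]])
      auto
qed (use assms in \<open>auto simp: B_simps subspace_scale nondegenerate_on_def\<close>)

end

locale hyperquadric_splitting = symmetric_form B for B :: "'a::euclidean_space \<Rightarrow> 'a \<Rightarrow> real" +
  fixes \<kappa> :: real and pbar :: 'a and V0 :: "'a set" and V :: "'k::finite \<Rightarrow> 'a set" and a :: "'k \<Rightarrow> 'a"
  assumes nondegenerate: "nondegenerate_on B UNIV" and \<kappa>_nonzero: "\<kappa> \<noteq> 0"
    and initial_data: "hyperquadric_initial_data B \<kappa> pbar V0 V a"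
begin

sublocale Q: quadric_section B UNIV UNIV 0 "1 / \<kappa>" \<kappa> "\<lambda>x. \<kappa> *\<^sub>R x" "hyperquadric B \<kappa>"
  using quadric_section_nondegenerate[OF subspace_UNIV nondegenerate open_UNIV \<kappa>_nonzero]
  by (simp add: hyperquadric_def)

abbreviation U0 :: "'a set" where "U0 \<equiv> span (insert pbar V0)"

abbreviation W :: "'k \<Rightarrow> 'a set" where "W i \<equiv> span (insert (a i) (V i))"

abbreviation \<kappa>' :: "'k \<Rightarrow> real" where "\<kappa>' i \<equiv> B (a i) (a i)"

section \<open>Linear algebra of the orthogonal splitting\<close>

lemma pbar_in: "pbar \<in> hyperquadric B \<kappa>" and B_pbar_pbar: "B pbar pbar = 1 / \<kappa>"
  using initial_data by (auto simp: hyperquadric_initial_data_def hyperquadric_def)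

lemma splitting: "orthogonal_decomposition B {w. B pbar w = 0} V0 V"
  using initial_data Q.tangent_space_eq[OF pbar_in] by (simp add: hyperquadric_initial_data_def)

lemma subspace_V0: "subspace V0" and subspace_V: "subspace (V i)" and V_nontrivial: "V i \<noteq> {0}"
  using splitting by (auto simp: orthogonal_decomposition_def)

lemma V0_V_orthogonal: "x \<in> V0 \<Longrightarrow> y \<in> V i \<Longrightarrow> B x y = 0"
  using splitting by (simp add: orthogonal_decomposition_def)

lemma V_orthogonal: "i \<noteq> j \<Longrightarrow> x \<in> V i \<Longrightarrow> y \<in> V j \<Longrightarrow> B x y = 0"
  using splitting unfolding orthogonal_decomposition_def by blast

lemma perp_pbar_iff:
  "B pbar w = 0 \<longleftrightarrow> (\<exists>v0 v. w = v0 + (\<Sum>i\<in>UNIV. v i) \<and> v0 \<in> V0 \<and> (\<forall>i. v i \<in> V i))"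
proof -
  have "{w. B pbar w = 0} = {v0 + (\<Sum>i\<in>UNIV. v i) | v0 v. v0 \<in> V0 \<and> (\<forall>i. v i \<in> V i)}"
    using splitting unfolding orthogonal_decomposition_def by (elim conjE)
  then show ?thesis by (auto simp: set_eq_iff)
qed

lemma pbar_V0: "w \<in> V0 \<Longrightarrow> B pbar w = 0"
  unfolding perp_pbar_iff using subspace_0[OF subspace_V]
  by (intro exI[of _ w] exI[of _ "\<lambda>i. 0"]) simp

lemma pbar_V: "w \<in> V i \<Longrightarrow> B pbar w = 0"
  unfolding perp_pbar_iff using subspace_0[OF subspace_V] subspace_0[OF subspace_V0]
  by (intro exI[of _ 0] exI[of _ "\<lambda>j. if j = i then w else 0"]) simp

lemma a_cases:
  obtains z where "\<And>i. z i \<in> V0" "\<And>i. a i = \<kappa> *\<^sub>R pbar - z i" "\<And>i j. i \<noteq> j \<Longrightarrow> B (z i) (z j) = - \<kappa>"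
  using initial_data unfolding hyperquadric_initial_data_def by metis

lemma a_in_U0: "a i \<in> U0"
proof -
  obtain z where "z i \<in> V0" "a i = \<kappa> *\<^sub>R pbar - z i" using a_cases by metis
  then show ?thesis by (simp add: span_diff span_scale span_base)
qed

lemma B_a_pbar: "B (a i) pbar = 1" and B_pbar_a: "B pbar (a i) = 1"
proof -
  obtain z where "z i \<in> V0" "a i = \<kappa> *\<^sub>R pbar - z i" using a_cases by metis
  then show "B pbar (a i) = 1" using pbar_V0[of "z i"] \<kappa>_nonzero by (simp add: B_simps B_pbar_pbar)
  then show "B (a i) pbar = 1" using form_commute by simp
qed

text \<open>The \<open>pbar\<close> parts contribute
  \<open>\<kappa>\<^sup>2 * (1 / \<kappa>) = \<kappa>\<close>, which cancels the prescribed product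
  of \<open>z i\<close> and \<open>z j\<close>.\<close>

lemma a_orthogonal:
  assumes "i \<noteq> j" shows "B (a i) (a j) = 0"
proof -
  obtain z where z: "\<And>i. z i \<in> V0" "\<And>i. a i = \<kappa> *\<^sub>R pbar - z i" "\<And>i j. i \<noteq> j \<Longrightarrow> B (z i) (z j) = - \<kappa>"
    using a_cases by metis
  then show ?thesis
    using pbar_V0 form_commute[of "z i" pbar] assms \<kappa>_nonzero by (simp add: B_simps B_pbar_pbar)
qed

lemma U0_V_orthogonal:
  assumes "u \<in> U0" and "v \<in> V i" shows "B u v = 0"
proof -
  have "B v u = 0"
  proof (rule form_zero_span[OF _ assms(1)])
    fix e assume "e \<in> insert pbar V0"
    then show "B v e = 0"
      using pbar_V[OF assms(2)] V0_V_orthogonal[OF _ assms(2)] form_commute[of v e] by auto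
  qed
  then show ?thesis using form_commute by simp
qed

lemma a_V: "v \<in> V j \<Longrightarrow> B (a i) v = 0"
  by (rule U0_V_orthogonal[OF a_in_U0])

lemma decomposition: "\<exists>u v. u \<in> U0 \<and> (\<forall>i. v i \<in> V i) \<and> x = u + (\<Sum>i\<in>UNIV. v i)"
proof -
  \<comment> \<open>The coefficient is the one of the orthogonal projection to the line of
    \<open>pbar\<close>; the remainder lies in the tangent space at \<open>pbar\<close>, which the
    initial data split.\<close>
  have "B pbar (x - (\<kappa> * B pbar x) *\<^sub>R pbar) = 0"
    using \<kappa>_nonzero by (simp add: B_simps B_pbar_pbar)
  then obtain v0 v where v: "x - (\<kappa> * B pbar x) *\<^sub>R pbar = v0 + (\<Sum>i\<in>UNIV. v i)" "v0 \<in> V0" "\<forall>i. v i \<in> V i"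
    unfolding perp_pbar_iff by blast
  show ?thesis
  proof (intro exI conjI)
    show "(\<kappa> * B pbar x) *\<^sub>R pbar + v0 \<in> U0"
      using v(2) by (simp add: span_add span_scale span_base)
    show "x = ((\<kappa> * B pbar x) *\<^sub>R pbar + v0) + (\<Sum>i\<in>UNIV. v i)"
      using v(1) by (simp add: algebra_simps)
  qed (rule v(3))
qed

lemma B_V_sum:
  assumes "\<And>j. v j \<in> V j" and "w \<in> V i"
  shows "B (\<Sum>j\<in>UNIV. v j) w = B (v i) w"
proof -
  have "B (\<Sum>j\<in>UNIV. v j) w = (\<Sum>j\<in>UNIV. if j = i then B (v i) w else 0)"
    unfolding B.sum_left using V_orthogonal assms by (intro sum.cong) auto
  then show ?thesis by simp
qed

text \<open>\<open>V i\<close> is orthogonal to all other summands, so its radical lies in the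
  radical of the whole space.\<close>

lemma nondegenerate_V: "nondegenerate_on B (V i)"
  unfolding nondegenerate_on_def
proof (intro ballI impI)
  fix x assume x: "x \<in> V i" "\<forall>y\<in>V i. B x y = 0"
  have "B x y = 0" for y
  proof -
    obtain u v where d: "u \<in> U0" "\<And>i. v i \<in> V i" "y = u + (\<Sum>i\<in>UNIV. v i)"
      using decomposition[of y] by blast
    have "B y x = B u x + B (v i) x"
      unfolding d(3) B.add_left using B_V_sum[OF d(2) x(1)] by simp
    also have "B u x = 0" by (rule U0_V_orthogonal[OF d(1) x(1)])
    also have "B (v i) x = 0" using x(2) d(2) form_commute[of "v i" x] by simp
    finally show ?thesis using form_commute[of x y] by simp
  qed
  then show "x = 0" using nondegenerate by (simp add: nondegenerate_on_def)
qed

lemma nondegenerate_U0: "nondegenerate_on B U0"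
  unfolding nondegenerate_on_def
proof (intro ballI impI)
  fix x assume x: "x \<in> U0" "\<forall>y\<in>U0. B x y = 0"
  have "B x y = 0" for y
  proof -
    obtain u v where d: "u \<in> U0" "\<And>i. v i \<in> V i" "y = u + (\<Sum>i\<in>UNIV. v i)"
      using decomposition[of y] by blast
    have "B x (v i) = 0" for i by (rule U0_V_orthogonal[OF x(1) d(2)])
    then show ?thesis
      unfolding d(3) B.add_right B.sum_right using x(2) d(1) by simp
  qed
  then show "x = 0" using nondegenerate by (simp add: nondegenerate_on_def)
qed

text \<open>The \<open>V i\<close>-parts of \<open>x\<close> are orthogonal to the nondegenerate
  spaces \<open>V i\<close> and hence vanish. Together with \<open>U0_V_orthogonal\<close> this
  makes \<open>U0\<close> the full orthogonal complement of the \<open>V i\<close>.\<close>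

lemma in_U0I:
  assumes "\<And>i v. v \<in> V i \<Longrightarrow> B x v = 0"
  shows "x \<in> U0"
proof -
  obtain u v where d: "u \<in> U0" "\<And>i. v i \<in> V i" "x = u + (\<Sum>i\<in>UNIV. v i)"
    using decomposition[of x] by blast
  have "v i = 0" for i
  proof -
    have "B (v i) w = 0" if "w \<in> V i" for w
      using assms[OF that] U0_V_orthogonal[OF d(1) that] B_V_sum[OF d(2) that]
      unfolding d(3) B.add_left by simp
    then show ?thesis using nondegenerate_V[of i] d(2) by (simp add: nondegenerate_on_def)
  qed
  then show ?thesis using d by simp
qed

lemma U0_perp_pbar: "{w \<in> U0. B pbar w = 0} = V0"
proof
  show "V0 \<subseteq> {w \<in> U0. B pbar w = 0}" using pbar_V0 by (auto intro: span_base)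
  show "{w \<in> U0. B pbar w = 0} \<subseteq> V0"
  proof
    fix w assume w: "w \<in> {w \<in> U0. B pbar w = 0}"
    then obtain r where r: "w - r *\<^sub>R pbar \<in> V0"
      using span_eq_iff[THEN iffD2, OF subspace_V0] by (auto simp: span_insert)
    then have "r = 0" using pbar_V0[OF r] w \<kappa>_nonzero by (simp add: B_simps B_pbar_pbar)
    then show "w \<in> V0" using r by simp
  qed
qed

text \<open>Pairing with \<open>pbar\<close> annihilates \<open>V i\<close> and is 1 on
  \<open>a i\<close>.\<close>

lemma W_decomposition:
  assumes "y \<in> W i" shows "y - B y pbar *\<^sub>R a i \<in> V i"
proof -
  obtain r where r: "y - r *\<^sub>R a i \<in> V i"
    using assms span_eq_iff[THEN iffD2, OF subspace_V[of i]] by (auto simp: span_insert)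
  then have "r = B pbar y" using pbar_V[OF r] by (simp add: B_simps B_pbar_a)
  then show ?thesis using r form_commute by simp
qed

lemma W_I: "v \<in> V i \<Longrightarrow> t *\<^sub>R a i + v \<in> W i"
  by (simp add: span_add span_scale span_base)

lemma W_perp_pbar: "{w \<in> W i. B pbar w = 0} = V i"
proof
  show "V i \<subseteq> {w \<in> W i. B pbar w = 0}" using pbar_V by (auto intro: span_base)
  show "{w \<in> W i. B pbar w = 0} \<subseteq> V i"
    using W_decomposition form_commute[of pbar] by fastforce
qed

lemma U0_W: 
  assumes "u \<in> U0" and "y \<in> W i" shows "B u y = B (a i) u * B y pbar"
  using U0_V_orthogonal[OF assms(1) W_decomposition[OF assms(2)]] form_commute[of u "a i"] by (simp add: B_simps)

lemma W_a: "y \<in> W i \<Longrightarrow> B y (a i) = \<kappa>' i * B y pbar"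
  using U0_W[OF a_in_U0] form_commute by metis

lemma W_W_orthogonal:
  assumes "i \<noteq> j" and "x \<in> W i" and "y \<in> W j" shows "B x y = 0"
proof -
  have "B (x - B x pbar *\<^sub>R a i) (y - B y pbar *\<^sub>R a j) = 0"
    using W_decomposition assms by (intro V_orthogonal[OF assms(1)]) auto
  moreover have "B (a i) y = 0"
    using U0_W[OF a_in_U0 assms(3), of i] a_orthogonal[of j i] assms(1) by simp
  moreover have "B x (a j) = 0"
    using U0_W[OF a_in_U0 assms(2), of j] a_orthogonal[of i j] assms(1) form_commute by simp
  ultimately show ?thesis using a_orthogonal[OF assms(1)] by (simp add: B_simps)
qed

text \<open>\<open>U0\<close> and \<open>W i\<close> overlap in the line of \<open>a i\<close>, so
  mixed terms survive; \<open>U0_W\<close> reduces them to products of scalars. The norm and the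
  isometry computation for the warped product map are both instances.\<close>

lemma form_split:
  assumes "u \<in> U0" "u' \<in> U0" and y: "\<And>i. y i \<in> W i" "\<And>i. y' i \<in> W i"
  shows "B (u + (\<Sum>i\<in>UNIV. y i)) (u' + (\<Sum>i\<in>UNIV. y' i)) =
    B u u' + (\<Sum>i\<in>UNIV. B (a i) u * B (y' i) pbar + B (a i) u' * B (y i) pbar + B (y i) (y' i))"
proof -
  have "B (\<Sum>i\<in>UNIV. y i) (y' j) = B (y j) (y' j)" for j
  proof -
    have "B (\<Sum>i\<in>UNIV. y i) (y' j) = (\<Sum>i\<in>UNIV. if i = j then B (y j) (y' j) else 0)"
      unfolding B.sum_left using W_W_orthogonal y by (intro sum.cong) auto
    then show ?thesis by simp
  qed
  moreover have "B u (y' i) = B (a i) u * B (y' i) pbar" "B (y i) u' = B (a i) u' * B (y i) pbar" for i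
    using U0_W y assms(1,2) form_commute by metis+
  ultimately show ?thesis
    by (simp add: B.add_left B.add_right B.sum_right sum.distrib)
      (simp add: B.sum_left)
qed

section \<open>Base and fibres as quadric sections\<close>

definition base :: "'a set" where
  "base = {x \<in> U0. B x x = 1 / \<kappa> \<and> x \<in> {x. \<forall>i. B (a i) x > 0}}"

definition fibre :: "'k \<Rightarrow> 'a set" where
  "fibre i = {x. x - pbar \<in> W i \<and> B x x = 1 / \<kappa>}"

lemma wp_scale_eq: "wp_scale B pbar a = (\<lambda>i. B (a i))"
  by (simp add: fun_eq_iff wp_scale_def B_simps B_a_pbar)

lemma wp_base_eq: "wp_base B pbar U0 a = {x \<in> U0. \<forall>i. B (a i) x > 0}"
proof -
  have pbar: "pbar \<in> U0" by (simp add: span_base)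
  have "x \<in> (+) pbar ` U0 \<longleftrightarrow> x \<in> U0" for x
  proof
    assume "x \<in> U0"
    then have "x - pbar \<in> U0" using pbar by (rule span_diff)
    moreover have "x = pbar + (x - pbar)" by simp
    ultimately show "x \<in> (+) pbar ` U0" by (rule rev_image_eqI)
  qed (auto intro: span_add pbar)
  then show ?thesis by (simp add: wp_base_def wp_scale_eq)
qed

text \<open>Written relative to \<open>pbar\<close>, the equation of the hyperquadric loses its
  constant term.\<close>

lemma form_offset: "B x x = 1 / \<kappa> \<longleftrightarrow> B (x - pbar) (x - pbar) + 2 * B (x - pbar) pbar = 0"
  using form_commute[of x pbar] by (simp add: B_simps B_pbar_pbar)

text \<open>Both kinds of fibres are the sections of the hyperquadric by the affine spaces
  \<open>pbar + W i\<close>: on \<open>W i\<close> the form \<open>B _ pbar\<close> is the \<open>a i\<close>-coordinate.\<close>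

lemma wp_fibre_eq: "wp_fibre B pbar V a i = fibre i"
proof (cases "\<kappa>' i = 0")
  case False
  show ?thesis
  proof (intro equalityI subsetI)
    fix x assume "x \<in> wp_fibre B pbar V a i"
    then obtain p where p: "p \<in> W i" "B p p = 1 / \<kappa>' i" "x = pbar - (1 / \<kappa>' i) *\<^sub>R a i + p"
      using False by (auto simp: wp_fibre_def Let_def)
    \<comment> \<open>The centre of the fibre is moved to \<open>pbar\<close>; \<open>W_a\<close>
      turns \<open>B p (a i)\<close> into a multiple of \<open>B p pbar\<close>, so the linear terms
      cancel.\<close>
    have "B (p - (1 / \<kappa>' i) *\<^sub>R a i) (p - (1 / \<kappa>' i) *\<^sub>R a i) + 2 * B (p - (1 / \<kappa>' i) *\<^sub>R a i) pbar = 0"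
      using False W_a[OF p(1)] form_commute[of "a i" p] by (simp add: B_simps p(2) B_a_pbar field_simps)
    then have "B x x = 1 / \<kappa>" unfolding form_offset p(3) by (simp add: algebra_simps)
    moreover have "x - pbar \<in> W i" using p(1) unfolding p(3) by (simp add: span_diff span_scale span_base)
    ultimately show "x \<in> fibre i" by (simp add: fibre_def)
  next
    fix x assume "x \<in> fibre i"
    then have x: "x - pbar \<in> W i" "B (x - pbar) (x - pbar) + 2 * B (x - pbar) pbar = 0"
      by (auto simp: fibre_def form_offset)
    define p where "p = (x - pbar) + (1 / \<kappa>' i) *\<^sub>R a i"
    have "p \<in> W i" unfolding p_def using x(1) by (intro span_add span_scale) (auto simp: span_base)
    have "B p p = B (x - pbar) (x - pbar) + 2 / \<kappa>' i * B (x - pbar) (a i) + 1 / \<kappa>' i"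
      using False form_commute[of "a i" "x - pbar"] unfolding p_def
      by (simp only: B.add_left B.add_right B.scaleR_left B.scaleR_right) (simp add: field_simps)
    also have "\<dots> = 1 / \<kappa>' i" using False x(2) W_a[OF x(1)] by simp
    finally have "p \<in> {p \<in> W i. B p p = 1 / \<kappa>' i}" using \<open>p \<in> W i\<close> by simp
    moreover have "x = pbar - (1 / \<kappa>' i) *\<^sub>R a i + p" by (simp add: p_def)
    ultimately show "x \<in> wp_fibre B pbar V a i"
      using False by (auto simp: wp_fibre_def Let_def)
  qed
next
  case True
  show ?thesis
  proof (intro equalityI subsetI)
    fix x assume "x \<in> wp_fibre B pbar V a i"
    then obtain p where p: "p \<in> V i" "x = pbar + (p - (1 / 2 * B p p) *\<^sub>R a i)"
      using True by (auto simp: wp_fibre_def)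
    have "B (p - (1 / 2 * B p p) *\<^sub>R a i) (p - (1 / 2 * B p p) *\<^sub>R a i) + 2 * B (p - (1 / 2 * B p p) *\<^sub>R a i) pbar = 0"
      using True a_V[OF p(1)] pbar_V[OF p(1)] form_commute[of p "a i"] form_commute[of p pbar] by (simp add: B_simps B_a_pbar)
    then have "B x x = 1 / \<kappa>" unfolding form_offset p(2) by simp
    moreover have "x - pbar \<in> W i" using W_I[OF p(1), of "- (1 / 2 * B p p)"] unfolding p(2) by simp
    ultimately show "x \<in> fibre i" by (simp add: fibre_def)
  next
    fix x assume "x \<in> fibre i"
    then have x: "x - pbar \<in> W i" "B (x - pbar) (x - pbar) + 2 * B (x - pbar) pbar = 0"
      by (auto simp: fibre_def form_offset)
    \<comment> \<open>\<open>t\<close> is the \<open>a i\<close>-coordinate. As \<open>a i\<close>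
      is null, the equation is only linear in it, \<open>B p p + 2 * t = 0\<close>, which gives the
      paraboloid.\<close>
    define t where "t = B (x - pbar) pbar"
    define p where "p = (x - pbar) - t *\<^sub>R a i"
    have p: "p \<in> V i" unfolding p_def t_def by (rule W_decomposition[OF x(1)])
    have xp: "x - pbar = p + t *\<^sub>R a i" by (simp add: p_def)
    have "B p p + 2 * t = 0"
      using x(2) True a_V[OF p] pbar_V[OF p] form_commute[of p "a i"] form_commute[of p pbar] unfolding xp by (simp add: B_simps B_a_pbar)
    then have "t = - (1 / 2 * B p p)" by simp
    then have "x = pbar + (p - (1 / 2 * B p p) *\<^sub>R a i)" using xp by (simp add: algebra_simps)
    then show "x \<in> wp_fibre B pbar V a i" using True p by (auto simp: wp_fibre_def)
  qed
qed

text \<open>Positivity of the scales only cuts out an open set, so it takes the role of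
  \<open>Q\<close>; \<open>base_def\<close> states it as a membership to match that shape.\<close>

sublocale base: quadric_section B U0 "{x. \<forall>i. B (a i) x > 0}" 0 "1 / \<kappa>" \<kappa> "\<lambda>x. \<kappa> *\<^sub>R x" base
proof -
  have "open (\<Inter>i\<in>UNIV. {x. 0 < B (a i) x})"
    by (intro open_INT ballI open_Collect_less continuous_intros B.continuous_on) auto
  moreover have "{x. \<forall>i. B (a i) x > 0} = (\<Inter>i\<in>UNIV. {x. 0 < B (a i) x})" by auto
  ultimately show "quadric_section B U0 {x. \<forall>i. B (a i) x > 0} 0 (1 / \<kappa>) \<kappa> (\<lambda>x. \<kappa> *\<^sub>R x) base"
    unfolding base_def by (intro quadric_section_nondegenerate nondegenerate_U0 \<kappa>_nonzero subspace_span) simp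
qed

text \<open>The normal field is half the derivative of \<open>\<kappa>' i * B y y\<close> at
  \<open>y = x - pbar\<close>, shifted by \<open>a i\<close>. Its square and its product with
  \<open>x\<close> are constant because both reduce to the bracket in \<open>form_offset\<close>,
  which vanishes on the fibre.\<close>

sublocale fibre: quadric_section B "W i" UNIV pbar "1 / \<kappa>" "\<kappa>' i" "\<lambda>x. \<kappa>' i *\<^sub>R (x - pbar) + a i" "fibre i" for i
proof unfold_locales
  show "fibre i = {x. x - pbar \<in> W i \<and> B x x = 1 / \<kappa> \<and> x \<in> UNIV}" by (simp add: fibre_def)
  show "smooth_map_on (fibre i) (\<lambda>x. \<kappa>' i *\<^sub>R (x - pbar) + a i)"
    by (rule smooth_map_onI[OF open_UNIV, where F = "\<lambda>x. \<kappa>' i *\<^sub>R (x - pbar) + a i"])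
      (auto intro!: smooth_on_open_add smooth_on_open_diff smooth_on_open_scaleR smooth_on_open_const smooth_on_open_id)
  fix x assume "x \<in> fibre i"
  then have x: "x - pbar \<in> W i" "B (x - pbar) (x - pbar) + 2 * B (x - pbar) pbar = 0" "B x x = 1 / \<kappa>"
    using form_offset by (auto simp: fibre_def)
  show "\<kappa>' i *\<^sub>R (x - pbar) + a i \<in> W i"
    using x(1) by (intro span_add span_scale) (auto simp: span_base)
  have xa: "B (x - pbar) (a i) = \<kappa>' i * B (x - pbar) pbar" by (rule W_a[OF x(1)])
  have "B x (\<kappa>' i *\<^sub>R (x - pbar) + a i) =
      \<kappa>' i * (B (x - pbar) (x - pbar) + B (x - pbar) pbar) + B (x - pbar) (a i) + 1"
    using form_commute[of x pbar] by (simp add: B_simps B_pbar_a algebra_simps)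
  also have "\<dots> = \<kappa>' i * (B (x - pbar) (x - pbar) + 2 * B (x - pbar) pbar) + 1"
    unfolding xa by (simp add: algebra_simps)
  finally show "B x (\<kappa>' i *\<^sub>R (x - pbar) + a i) = 1" unfolding x(2) by simp
  have "B (\<kappa>' i *\<^sub>R (x - pbar) + a i) (\<kappa>' i *\<^sub>R (x - pbar) + a i) =
      \<kappa>' i * (\<kappa>' i * B (x - pbar) (x - pbar) + 2 * B (x - pbar) (a i)) + \<kappa>' i"
    using form_commute[of "a i" "x - pbar"]
    by (simp only: B.add_left B.add_right B.scaleR_left B.scaleR_right) (simp add: algebra_simps)
  also have "\<dots> = \<kappa>' i * \<kappa>' i * (B (x - pbar) (x - pbar) + 2 * B (x - pbar) pbar) + \<kappa>' i"
    unfolding xa by (simp add: algebra_simps)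
  finally show "B (\<kappa>' i *\<^sub>R (x - pbar) + a i) (\<kappa>' i *\<^sub>R (x - pbar) + a i) = \<kappa>' i" unfolding x(2) by simp
  {
    fix w assume w: "w \<in> W i" "B x w = 0"
    show "B (\<kappa>' i *\<^sub>R (x - pbar) + a i) w = 0"
      using w(2) W_a[OF w(1)] form_commute[of w "a i"] form_commute[of w x] form_commute[of w pbar] by (simp add: B_simps algebra_simps)
  }
  {
    fix w assume w: "w \<in> W i" "\<And>u. u \<in> W i \<Longrightarrow> B w u = 0" "B x w = 0"
    \<comment> \<open>A vector in the radical of \<open>W i\<close> has no \<open>V i\<close>-part,
      so it is \<open>t *\<^sub>R a i\<close> with \<open>t = B w pbar\<close>. Pairing with
      \<open>a i\<close> gives \<open>t * \<kappa>' i = 0\<close>, pairing with \<open>x\<close>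
      gives \<open>t * (1 + \<kappa>' i * B (x - pbar) pbar) = 0\<close>; together they force
      \<open>t = 0\<close>, also when \<open>\<kappa>' i = 0\<close>.\<close>
    define v where "v = w - B w pbar *\<^sub>R a i"
    have v: "v \<in> V i" unfolding v_def by (rule W_decomposition[OF w(1)])
    have "B v u = 0" if "u \<in> V i" for u
      using w(2)[of u] that a_V[OF that] unfolding v_def by (simp add: B_simps span_base)
    then have "v = 0" using nondegenerate_V v by (auto simp: nondegenerate_on_def)
    then have w': "w = B w pbar *\<^sub>R a i" by (simp add: v_def)
    have "B w pbar * \<kappa>' i = 0"
      using w(2)[of "a i"] W_a[OF w(1)] by (simp add: span_base mult.commute)
    moreover have "B w pbar * (1 + \<kappa>' i * B (x - pbar) pbar) = 0"
    proof -
      have "B w pbar * B x (a i) = B x (B w pbar *\<^sub>R a i)" by (simp add: B_simps)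
      also have "\<dots> = 0" using w(3) w' by simp
      finally have "B w pbar * B x (a i) = 0" .
      moreover have "B x (a i) = 1 + \<kappa>' i * B (x - pbar) pbar"
        using xa by (simp add: B_simps B_pbar_a)
      ultimately show ?thesis by simp
    qed
    ultimately have "B w pbar = 0" by (auto simp: algebra_simps)
    then show "w = 0" using w' by simp
  }
qed (auto simp: subspace_span)

end

context hyperquadric_splitting
begin

section \<open>The warped product map, its differential and its inverse\<close>

abbreviation P :: "('a \<times> ('a ^ 'k)) set" where "P \<equiv> product_manifold base fibre"

abbreviation F :: "'a \<times> ('a ^ 'k) \<Rightarrow> 'a" where "F \<equiv> wp_map B pbar a"

lemma F_eq: "F x = fst x + (\<Sum>i\<in>UNIV. B (a i) (fst x) *\<^sub>R (snd x $ i - pbar))"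
  by (simp add: wp_map_def wp_scale_eq split: prod.split)

lemma base_D:
  assumes "x \<in> base" shows "x \<in> U0" "B x x = 1 / \<kappa>" "B (a i) x > 0"
  using assms by (auto simp: base_def)

lemma fibre_D:
  assumes "x \<in> fibre i"
  shows "x - pbar \<in> W i" "B (x - pbar) (x - pbar) = - 2 * B (x - pbar) pbar"
  using assms form_offset[of x] by (auto simp: fibre_def)

lemma P_D:
  assumes "x \<in> P" shows "fst x \<in> base" "snd x $ i \<in> fibre i"
  using assms by (auto simp: product_manifold_def)

text \<open>The contribution of each fibre is the squared scale times the left side of the fibre
  equation in \<open>form_offset\<close>, hence 0.\<close>

lemma F_norm:
  assumes "u \<in> U0" and "\<And>i. p $ i \<in> fibre i"
  shows "B (F (u, p)) (F (u, p)) = B u u"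
proof -
  let ?y = "\<lambda>i. B (a i) u *\<^sub>R (p $ i - pbar)"
  have y: "?y i \<in> W i" for i using fibre_D(1)[OF assms(2)] by (rule span_scale)
  have "B (a i) u * B (?y i) pbar + B (a i) u * B (?y i) pbar + B (?y i) (?y i) = 0" for i
    using fibre_D(2)[OF assms(2)[of i]] by (simp only: B.scaleR_left B.scaleR_right) simp
  then show ?thesis
    using form_split[of u u ?y ?y] assms(1) y by (simp add: F_eq)
qed

lemma F_derivative:
  "(F has_derivative (\<lambda>v. fst v + (\<Sum>i\<in>UNIV. B (a i) (fst x) *\<^sub>R (snd v $ i) +
     B (a i) (fst v) *\<^sub>R (snd x $ i - pbar)))) (at x)"
proof -
  have 1: "((\<lambda>x. B (a i) (fst x)) has_derivative (\<lambda>v. B (a i) (fst v))) (at x)" for i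
    by (rule bounded_linear.has_derivative[OF B.bounded_linear_right has_derivative_fst[OF has_derivative_ident]])
  have 2: "((\<lambda>x. snd x $ i - pbar) has_derivative (\<lambda>v. snd v $ i - 0)) (at x)" for i
    by (intro has_derivative_diff has_derivative_const
        bounded_linear.has_derivative[OF bounded_linear_vec_nth has_derivative_snd[OF has_derivative_ident]])
  have 3: "((\<lambda>x. B (a i) (fst x) *\<^sub>R (snd x $ i - pbar)) has_derivative
      (\<lambda>v. B (a i) (fst x) *\<^sub>R (snd v $ i) + B (a i) (fst v) *\<^sub>R (snd x $ i - pbar))) (at x)" for i
    using has_derivative_scaleR[OF 1 2] by simp
  show ?thesis
    unfolding F_eq[abs_def]
    by (intro has_derivative_add has_derivative_sum 3 has_derivative_fst[OF has_derivative_ident])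
qed

lemma F_smooth: "smooth_on_open UNIV F"
  unfolding F_eq[abs_def]
  by (intro smooth_on_open_add smooth_on_open_sum smooth_on_open_scaleR smooth_on_open_diff open_UNIV
      smooth_on_open_const smooth_on_open_bounded_linear[OF _ B.bounded_linear_right]
      smooth_on_open_bounded_linear[OF _ bounded_linear_vec_nth]
      smooth_on_open_bounded_linear[OF _ bounded_linear_fst]
      smooth_on_open_bounded_linear[OF _ bounded_linear_snd] smooth_on_open_id)

text \<open>Curves in the product project to curves in the factors; this inclusion is what the
  isometry computation uses.\<close>

lemma tangent_space_P:
  assumes "x \<in> P" and "v \<in> tangent_space P x"
  shows "fst v \<in> U0" "snd v $ i \<in> W i" "B (snd x $ i) (snd v $ i) = 0"
proof -
  have "fst v \<in> tangent_space base (fst x)"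
    by (rule tangent_space_bounded_linear_image[OF bounded_linear_fst assms(2)]) (auto intro: P_D)
  then show "fst v \<in> U0" using base.tangent_space_eq P_D(1)[OF assms(1)] by simp
  have "snd v $ i \<in> tangent_space (fibre i) (snd x $ i)"
    by (rule tangent_space_bounded_linear_image
        [OF bounded_linear_compose[OF bounded_linear_vec_nth bounded_linear_snd] assms(2)])
      (auto intro: P_D(2))
  then show "snd v $ i \<in> W i" "B (snd x $ i) (snd v $ i) = 0"
    using fibre.tangent_space_eq[OF P_D(2)[OF assms(1)]] by auto
qed

text \<open>A fibre tangent vector \<open>v\<close> at \<open>p\<close> is orthogonal to
  \<open>p\<close>, so \<open>B (p - pbar) v = - B v pbar\<close>. With the fibre equation this
  cancels in \<open>form_split\<close> all terms that contain a derivative of a warping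
  function.\<close>

lemma F_isometric:
  assumes x: "x \<in> P" and v: "v \<in> tangent_space P x" and w: "w \<in> tangent_space P x"
  defines "D \<equiv> \<lambda>v. fst v + (\<Sum>i\<in>UNIV. B (a i) (fst x) *\<^sub>R (snd v $ i) +
     B (a i) (fst v) *\<^sub>R (snd x $ i - pbar))"
  shows "B (D v) (D w) = B (fst v) (fst w) + (\<Sum>i\<in>UNIV. (B (a i) (fst x))\<^sup>2 * B (snd v $ i) (snd w $ i))"
proof -
  let ?y = "\<lambda>v i. B (a i) (fst x) *\<^sub>R (snd v $ i) + B (a i) (fst v) *\<^sub>R (snd x $ i - pbar)"
  have q: "snd x $ i - pbar \<in> W i" "B (snd x $ i - pbar) (snd x $ i - pbar) = - 2 * B (snd x $ i - pbar) pbar" for i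
    using fibre_D[OF P_D(2)[OF x]] by auto
  have y: "?y v i \<in> W i" "?y w i \<in> W i" for i
    using q(1) tangent_space_P(2)[OF x v] tangent_space_P(2)[OF x w] by (simp_all add: span_add span_scale)
  have qv: "B (snd x $ i - pbar) (snd u $ i) = - B (snd u $ i) pbar" if "u \<in> tangent_space P x" for u i
    using tangent_space_P(3)[OF x that] form_commute[of pbar "snd u $ i"] by (simp add: B_simps)
  have "B (a i) (fst v) * B (?y w i) pbar + B (a i) (fst w) * B (?y v i) pbar + B (?y v i) (?y w i)
      = (B (a i) (fst x))\<^sup>2 * B (snd v $ i) (snd w $ i)" for i
  proof -
    define q' where "q' = snd x $ i - pbar"
    have "B q' q' = - 2 * B q' pbar" "B q' (snd v $ i) = - B (snd v $ i) pbar"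
      "B q' (snd w $ i) = - B (snd w $ i) pbar" "B (snd v $ i) q' = - B (snd v $ i) pbar"
      using q(2) qv[OF v] qv[OF w] form_commute[of "snd v $ i" q'] by (auto simp: q'_def)
    then show ?thesis
      unfolding q'_def[symmetric] by (simp add: B_simps power2_eq_square algebra_simps)
  qed
  then show ?thesis
    using form_split[OF tangent_space_P(1)[OF x v] tangent_space_P(1)[OF x w] y] by (simp add: D_def)
qed

text \<open>The inverse of \<open>F\<close>.  For \<open>x = F (p0, p)\<close> the scale \<open>\<rho> = B (a i) p0\<close> satisfies
  \<open>\<rho>\<^sup>2 = (B (a i) x)\<^sup>2 + \<kappa>' i * B w w\<close>, where \<open>w\<close> is the \<open>V i\<close>-component of \<open>x\<close>;
  \<open>coord\<close> recovers the \<open>a i\<close>-coordinate of \<open>p $ i - pbar\<close>.\<close>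

definition component :: "'k \<Rightarrow> 'a \<Rightarrow> 'a" where "component i = form_projection B (V i)"

text \<open>For \<open>\<kappa>' i = 0\<close> the squared formula would lose the sign of
  \<open>B (a i) x\<close>, which is then the scale itself and must be positive on the image; for
  other \<open>\<kappa>' i\<close> that number may have either sign there.\<close>

definition disc :: "'k \<Rightarrow> 'a \<Rightarrow> real" where
  "disc i x = (if \<kappa>' i = 0 then B (a i) x else (B (a i) x)\<^sup>2 + \<kappa>' i * B (component i x) (component i x))"

definition scale :: "'k \<Rightarrow> 'a \<Rightarrow> real" where
  "scale i x = (if \<kappa>' i = 0 then B (a i) x else sqrt ((B (a i) x)\<^sup>2 + \<kappa>' i * B (component i x) (component i x)))"

text \<open>On the image \<open>B (a i) x = \<rho> * (1 + \<kappa>' i * t)\<close> with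
  \<open>t\<close> the sought coordinate, which is solved for \<open>t\<close> if
  \<open>\<kappa>' i\<close> is nonzero. Otherwise \<open>t\<close> comes from the fibre equation
  \<open>B v v + 2 * t = 0\<close>, where the \<open>V i\<close>-component of \<open>x\<close> is
  \<open>\<rho> *\<^sub>R v\<close>.\<close>

definition coord :: "'k \<Rightarrow> 'a \<Rightarrow> real" where
  "coord i x = (if \<kappa>' i = 0 then - B (component i x) (component i x) / (2 * (scale i x * scale i x))
     else (B (a i) x / scale i x - 1) / \<kappa>' i)"

definition offset :: "'k \<Rightarrow> 'a \<Rightarrow> 'a" where
  "offset i x = coord i x *\<^sub>R a i + (1 / scale i x) *\<^sub>R component i x"

definition G :: "'a \<Rightarrow> 'a \<times> ('a ^ 'k)" where
  "G x = (x - (\<Sum>i\<in>UNIV. scale i x *\<^sub>R offset i x), \<chi> i. pbar + offset i x)"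

definition domain :: "'a set" where "domain = {x. \<forall>i. disc i x > 0}"

lemma component_in: "component i x \<in> V i" and component_perp: "u \<in> V i \<Longrightarrow> B (component i x) u = B x u"
  using form_projection_in[OF subspace_V nondegenerate_V, of i x]
    form_projection_perp[OF subspace_V nondegenerate_V, of u i x]
  by (auto simp: component_def B_simps)

lemma component_eqI: "w \<in> V i \<Longrightarrow> (\<And>u. u \<in> V i \<Longrightarrow> B w u = B x u) \<Longrightarrow> component i x = w"
  unfolding component_def by (rule form_projection_eqI[OF subspace_V nondegenerate_V]) (auto simp: B_simps)

lemma bounded_linear_component: "bounded_linear (component i)"
  unfolding component_def by (rule bounded_linear_form_projection[OF subspace_V nondegenerate_V])

lemma scale_pos: "x \<in> domain \<Longrightarrow> scale i x > 0"
  unfolding domain_def disc_def scale_def by (auto dest: spec[of _ i] split: if_splits)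

lemma open_domain: "open domain"
proof -
  have "open {x. 0 < disc i x}" for i
    using linear_continuous_on[OF bounded_linear_component[of i]]
    by (cases "\<kappa>' i = 0") (auto simp: disc_def intro!: open_Collect_less continuous_intros B.continuous_on)
  then have "open (\<Inter>i\<in>UNIV. {x. 0 < disc i x})" by (intro open_INT) auto
  moreover have "domain = (\<Inter>i\<in>UNIV. {x. 0 < disc i x})" by (auto simp: domain_def)
  ultimately show ?thesis by simp
qed

lemma smooth_G: "smooth_on_open domain G"
proof -
  note [intro] = open_domain
  have component: "smooth_on_open domain (component i)" for i
    by (rule smooth_on_open_bounded_linear[OF open_domain bounded_linear_component smooth_on_open_id[OF open_domain]])
  have a: "smooth_on_open domain (B (a i))" for i
    by (rule smooth_on_open_bounded_linear[OF open_domain B.bounded_linear_right smooth_on_open_id[OF open_domain]])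
  have disc: "smooth_on_open domain (disc i)" for i
    unfolding disc_def power2_eq_square
    by (cases "\<kappa>' i = 0") (auto intro!: smooth_on_open_add smooth_on_open_mult smooth_on_open_const
        smooth_on_open_form component a)
  have scale: "smooth_on_open domain (scale i)" for i
  proof (cases "\<kappa>' i = 0")
    case True
    then show ?thesis using a by (simp add: scale_def[abs_def])
  next
    case False
    have "scale i = (\<lambda>x. sqrt (disc i x))" using False by (auto simp: scale_def disc_def)
    then show ?thesis
      using smooth_on_open_sqrt[OF open_domain disc] by (simp add: domain_def)
  qed
  have pos: "x \<in> domain \<Longrightarrow> scale i x \<noteq> 0" for i x using scale_pos[of x i] by simp
  have coord: "smooth_on_open domain (coord i)" for i
  proof (cases "\<kappa>' i = 0")
    case True
    have "smooth_on_open domain (\<lambda>x. - B (component i x) (component i x) / (2 * (scale i x * scale i x)))"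
      using pos by (intro smooth_on_open_divide smooth_on_open_minus smooth_on_open_mult
          smooth_on_open_const smooth_on_open_form component scale open_domain) auto
    then show ?thesis using True by (simp add: coord_def[abs_def])
  next
    case False
    have "smooth_on_open domain (\<lambda>x. (B (a i) x / scale i x - 1) / \<kappa>' i)"
      using pos False by (intro smooth_on_open_divide smooth_on_open_diff
          smooth_on_open_const a scale open_domain) auto
    then show ?thesis using False by (simp add: coord_def[abs_def])
  qed
  have offset: "smooth_on_open domain (offset i)" for i
    unfolding offset_def[abs_def] using pos
    by (intro smooth_on_open_add smooth_on_open_scaleR smooth_on_open_divide
        smooth_on_open_const coord scale component open_domain)
  show ?thesis
    unfolding G_def[abs_def]
    by (intro smooth_on_open_Pair smooth_on_open_vec smooth_on_open_add smooth_on_open_diff smooth_on_open_sum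
        smooth_on_open_scaleR smooth_on_open_const smooth_on_open_id scale offset open_domain)
qed

lemma G_F:
  assumes x: "x \<in> P"
  shows "F x \<in> hyperquadric B \<kappa> \<inter> domain" and "G (F x) = x"
proof -
  obtain p0 p where xp: "x = (p0, p)" by (cases x)
  have p0: "p0 \<in> base" and p: "\<And>i. p $ i \<in> fibre i" using P_D[OF x] by (auto simp: xp)
  note p0' = base_D[OF p0]
  define q where "q i = p $ i - pbar" for i
  define \<rho> where "\<rho> i = B (a i) p0" for i
  define t where "t i = B (q i) pbar" for i
  have \<rho>: "\<rho> i > 0" for i using p0'(3) by (simp add: \<rho>_def)
  have q: "q i \<in> W i" "B (q i) (q i) = - 2 * t i" for i
    using fibre_D[OF p[of i]] by (auto simp: q_def t_def)
  define v where "v i = q i - t i *\<^sub>R a i" for i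
  have v: "v i \<in> V i" for i unfolding v_def t_def by (rule W_decomposition[OF q(1)])
  have Fx: "F x = p0 + (\<Sum>i\<in>UNIV. \<rho> i *\<^sub>R q i)" by (simp add: F_eq xp q_def \<rho>_def)
  have Bsum: "B (\<Sum>j\<in>UNIV. \<rho> j *\<^sub>R q j) y = \<rho> i * B (q i) y" if y: "y \<in> W i" for y i
  proof -
    have "B (\<Sum>j\<in>UNIV. \<rho> j *\<^sub>R q j) y = (\<Sum>j\<in>UNIV. if j = i then \<rho> i * B (q i) y else 0)"
      unfolding B.sum_left using W_W_orthogonal[OF _ q(1) y] by (intro sum.cong) (auto simp: B_simps)
    then show ?thesis by simp
  qed
  have component: "component i (F x) = \<rho> i *\<^sub>R v i" for i
  proof (rule component_eqI)
    show "\<rho> i *\<^sub>R v i \<in> V i" by (rule subspace_scale[OF subspace_V v])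
    fix u assume u: "u \<in> V i"
    then show "B (\<rho> i *\<^sub>R v i) u = B (F x) u"
      using U0_V_orthogonal[OF p0'(1) u] Bsum[of u i] a_V[OF u] by (simp add: Fx v_def B_simps span_base)
  qed
  have Ba: "B (a i) (F x) = \<rho> i * (1 + \<kappa>' i * t i)" for i
  proof -
    have "B (F x) (a i) = \<rho> i + \<rho> i * B (q i) (a i)"
      using Bsum[of "a i" i] form_commute[of p0 "a i"] by (simp add: Fx B_simps span_base \<rho>_def)
    then show ?thesis using W_a[OF q(1)] form_commute[of "a i" "F x"] by (simp add: t_def algebra_simps)
  qed
  have vv: "B (v i) (v i) = - 2 * t i - \<kappa>' i * (t i)\<^sup>2" for i
    using q(2)[of i] W_a[OF q(1)[of i]] form_commute[of "a i" "q i"]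
    by (simp add: v_def B_simps t_def power2_eq_square algebra_simps)
  \<comment> \<open>The factor of \<open>(\<rho> i)\<^sup>2\<close> on the left is \<open>(1 +
    \<kappa>' i * t i)\<^sup>2 - \<kappa>' i * (2 * t i + \<kappa>' i * (t i)\<^sup>2)\<close>,
    which equals 1.\<close>
  have sq: "(B (a i) (F x))\<^sup>2 + \<kappa>' i * B (component i (F x)) (component i (F x)) = (\<rho> i)\<^sup>2" for i
    unfolding component Ba by (simp add: B_simps vv power2_eq_square algebra_simps)
  have scale: "scale i (F x) = \<rho> i" for i
    using sq[of i] \<rho>[of i] Ba[of i] by (simp add: scale_def)
  have "disc i (F x) > 0" for i
    using sq[of i] \<rho>[of i] Ba[of i] by (simp add: disc_def)
  moreover have "B (F x) (F x) = 1 / \<kappa>"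
    using F_norm[OF p0'(1) p] p0'(2) by (simp add: xp)
  ultimately show "F x \<in> hyperquadric B \<kappa> \<inter> domain" by (simp add: domain_def hyperquadric_def)
  have coord: "coord i (F x) = t i" for i
    using \<rho>[of i] vv[of i] by (cases "\<kappa>' i = 0") (simp_all add: coord_def scale component B_simps Ba)
  have offset: "offset i (F x) = q i" for i
    using \<rho>[of i] by (simp add: offset_def coord scale component v_def)
  have "G (F x) = (F x - (\<Sum>i\<in>UNIV. \<rho> i *\<^sub>R q i), \<chi> i. pbar + q i)"
    by (simp add: G_def scale offset)
  also have "\<dots> = (p0, p)" by (simp add: Fx q_def vec_eq_iff)
  finally show "G (F x) = x" by (simp only: xp)
qed

lemma F_G:
  assumes x: "x \<in> hyperquadric B \<kappa> \<inter> domain"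
  shows "G x \<in> P" and "F (G x) = x"
proof -
  have pos: "scale i x > 0" for i using scale_pos x by blast
  define p0 where "p0 = fst (G x)"
  have snd: "snd (G x) $ i = pbar + offset i x" for i by (simp add: G_def)
  have fst: "p0 = x - (\<Sum>i\<in>UNIV. scale i x *\<^sub>R offset i x)" by (simp add: p0_def G_def)
  have off: "offset i x \<in> W i" for i
    unfolding offset_def by (intro W_I subspace_scale[OF subspace_V] component_in)
  have Bsum: "B (\<Sum>j\<in>UNIV. scale j x *\<^sub>R offset j x) y = scale i x * B (offset i x) y" if y: "y \<in> W i" for y i
  proof -
    have "B (\<Sum>j\<in>UNIV. scale j x *\<^sub>R offset j x) y =
        (\<Sum>j\<in>UNIV. if j = i then scale i x * B (offset i x) y else 0)"
      unfolding B.sum_left using W_W_orthogonal[OF _ off y] by (intro sum.cong) (auto simp: B_simps)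
    then show ?thesis by simp
  qed
  have p0: "p0 \<in> U0"
  proof (rule in_U0I)
    fix i v assume v: "v \<in> V i"
    then have "B (offset i x) v = (1 / scale i x) * B x v"
      using a_V[OF v] component_perp[OF v] by (simp add: offset_def B_simps)
    then show "B p0 v = 0"
      using Bsum[of v i] v pos[of i] by (simp add: fst B_simps span_base)
  qed
  have coord: "B (offset i x) pbar = coord i x" for i
    using pbar_V[OF component_in[of i x]] form_commute[of pbar "component i x"] by (simp add: offset_def B_simps B_a_pbar)
  have Ba: "B (a i) p0 = scale i x" for i
  proof -
    have "B p0 (a i) = B x (a i) - scale i x * (\<kappa>' i * coord i x)"
      using Bsum[of "a i" i] W_a[OF off] coord by (simp add: fst B_simps span_base)
    also have "\<dots> = scale i x"
      using pos[of i] form_commute[of x "a i"] by (cases "\<kappa>' i = 0") (simp_all add: coord_def scale_def[of i] field_simps)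
    finally show ?thesis using form_commute by simp
  qed
  have fib: "pbar + offset i x \<in> fibre i" for i
  proof -
    have "B (offset i x) (offset i x) = \<kappa>' i * (coord i x)\<^sup>2 + B (component i x) (component i x) / (scale i x)\<^sup>2"
      using a_V[OF component_in[of i x]] form_commute[of "component i x" "a i"]
      by (simp add: offset_def B_simps power2_eq_square)
    also have "\<dots> = - 2 * coord i x"
    proof (cases "\<kappa>' i = 0")
      case True
      then show ?thesis using pos[of i] by (simp add: coord_def power2_eq_square)
    next
      case False
      have "disc i x > 0" using x by (simp add: domain_def)
      then have sq: "(scale i x)\<^sup>2 = (B (a i) x)\<^sup>2 + \<kappa>' i * B (component i x) (component i x)"
        using False by (simp add: disc_def scale_def)
      \<comment> \<open>Completing the square in \<open>coord i x\<close> matches the definition of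
        \<open>scale\<close>; the fibre equation comes out multiplied by \<open>\<kappa>' i\<close>,
        which is nonzero here.\<close>
      have "\<kappa>' i * coord i x = B (a i) x / scale i x - 1"
        using False by (simp add: coord_def)
      then have "(1 + \<kappa>' i * coord i x)\<^sup>2 = (B (a i) x)\<^sup>2 / (scale i x)\<^sup>2"
        by (simp add: power_divide)
      also have "\<dots> = ((scale i x)\<^sup>2 - \<kappa>' i * B (component i x) (component i x)) / (scale i x)\<^sup>2"
        unfolding sq by simp
      also have "\<dots> = 1 - \<kappa>' i * (B (component i x) (component i x) / (scale i x)\<^sup>2)"
        using pos[of i] by (simp add: field_simps)
      finally have "\<kappa>' i * (\<kappa>' i * (coord i x)\<^sup>2 + B (component i x) (component i x) / (scale i x)\<^sup>2 + 2 * coord i x) = 0"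
        by (simp add: power2_eq_square algebra_simps)
      then show ?thesis using False by simp
    qed
    finally have "B (pbar + offset i x) (pbar + offset i x) = 1 / \<kappa>"
      unfolding form_offset by (simp add: coord)
    then show ?thesis using off by (simp add: fibre_def)
  qed
  show FG: "F (G x) = x"
    unfolding F_eq snd p0_def[symmetric] Ba by (simp add: fst)
  \<comment> \<open>\<open>F_norm\<close> is read backwards: \<open>F (G x) = x\<close> lies on the
    hyperquadric, so the base point does too. There is no circularity, as \<open>F_norm\<close> asks
    for \<open>p0\<close> only to lie in \<open>U0\<close>.\<close>
  have "B p0 p0 = 1 / \<kappa>"
    using F_norm[OF p0, of "snd (G x)"] fib FG x by (simp add: snd p0_def hyperquadric_def)
  then have "p0 \<in> base" using p0 Ba pos by (simp add: base_def)
  then have "(p0, snd (G x)) \<in> P"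
    using fib by (simp add: product_manifold_def snd)
  then show "G x \<in> P" by (simp add: p0_def)
qed

lemma F_image: "F ` P = hyperquadric B \<kappa> \<inter> domain"
  using G_F(1) F_G by force

lemma inj_F: "inj_on F P"
  using G_F(2) by (metis inj_onI)

lemma pbar_in_fibre: "pbar \<in> fibre i"
  using span_zero by (simp add: fibre_def B_pbar_pbar)

lemma pbar_in_base: "pbar \<in> base"
  by (simp add: base_def B_pbar_pbar span_base B_a_pbar)

lemma F_pbar: "(pbar, \<chi> i. pbar) \<in> P" "F (pbar, \<chi> i. pbar) = pbar"
  using pbar_in_base pbar_in_fibre by (auto simp: product_manifold_def F_eq)

text \<open>\<open>\<phi>\<close> is prescribed on \<open>P\<close> only, since it will be a
  restricted function; \<open>F\<close> and \<open>G\<close> are the smooth ambient extensions of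
  \<open>\<phi>\<close> and its inverse.\<close>

lemma decomposition_of_hyperquadric:
  assumes \<phi>: "\<And>x. x \<in> P \<Longrightarrow> \<phi> x = F x"
  shows "warped_product_decomposition (hyperquadric B \<kappa>) (induced_metric B)
    base (induced_metric B) (\<lambda>i. B (a i)) fibre (\<lambda>i. induced_metric B) \<phi>"
  unfolding warped_product_decomposition_def isometry_between_def
proof (intro conjI allI ballI)
  have image: "\<phi> ` P = hyperquadric B \<kappa> \<inter> domain"
    unfolding F_image[symmetric] using \<phi> by (rule image_cong[OF refl])
  show "pseudo_riemannian (hyperquadric B \<kappa>) (induced_metric B)" by (rule Q.pseudo_riemannian_M)
  show "pseudo_riemannian base (induced_metric B)" by (rule base.pseudo_riemannian_M)
  show "pseudo_riemannian (fibre i) (induced_metric B)" for i by (rule fibre.pseudo_riemannian_M)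
  show "smooth_map_on base (B (a i))" for i
    by (rule smooth_map_onI[OF open_UNIV, where F = "B (a i)"])
      (auto intro: smooth_on_open_bounded_linear[OF _ B.bounded_linear_right smooth_on_open_id])
  show "B (a i) x > 0" if "x \<in> base" for i x using base_D(3)[OF that] .
  show "\<phi> ` P \<noteq> {}" using F_pbar(1) by blast
  show "openin (top_of_set (hyperquadric B \<kappa>)) (\<phi> ` P)"
    unfolding image using open_domain by (rule openin_open_Int)
  have inj: "inj_on \<phi> P" using inj_F \<phi> inj_on_cong by metis
  then show "bij_betw \<phi> P (\<phi> ` P)" by (rule inj_on_imp_bij_betw)
  show "smooth_map_on P \<phi>"
    by (rule smooth_map_onI[OF open_UNIV _ F_smooth]) (auto simp: \<phi>)
  show "smooth_map_on (\<phi> ` P) (inv_into P \<phi>)"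
  proof (rule smooth_map_onI[OF open_domain _ smooth_G])
    show "\<phi> ` P \<subseteq> domain" unfolding image by blast
    fix y assume "y \<in> \<phi> ` P"
    then have y: "y \<in> hyperquadric B \<kappa> \<inter> domain" by (simp only: image)
    show "G y = inv_into P \<phi> y"
      using F_G[OF y] \<phi> by (metis inv_into_f_f inj)
  qed
  fix p v w assume p: "p \<in> P" and v: "v \<in> tangent_space P p" and w: "w \<in> tangent_space P p"
  have D: "differential P \<phi> p u = fst u + (\<Sum>i\<in>UNIV. B (a i) (fst p) *\<^sub>R (snd u $ i) +
     B (a i) (fst u) *\<^sub>R (snd p $ i - pbar))" if "u \<in> tangent_space P p" for u
    by (rule differential_eqI[OF that open_UNIV UNIV_I F_derivative]) (simp add: \<phi>)
  show "induced_metric B (\<phi> p) (differential P \<phi> p v) (differential P \<phi> p w) =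
      warped_metric (induced_metric B) (\<lambda>i. B (a i)) (\<lambda>i. induced_metric B) p v w"
    unfolding warped_metric_def induced_metric_def D[OF v] D[OF w] by (rule F_isometric[OF p v w])
qed

text \<open>All scales are 1 at \<open>pbar\<close>, so the leaves through \<open>pbar\<close> are
  the base and the fibres themselves. Their tangent spaces are the parts of \<open>U0\<close> and
  \<open>W i\<close> orthogonal to \<open>pbar\<close>, and the normal field of a fibre takes the
  value \<open>a i\<close> there.\<close>

lemma determined_by_initial_data:
  assumes \<phi>: "\<And>x. x \<in> P \<Longrightarrow> \<phi> x = F x"
  shows "determined_by B \<kappa> base fibre \<phi> pbar V0 V a"
proof -
  have inj: "inj_on \<phi> P" using inj_F \<phi> inj_on_cong by metis
  have \<phi>_pbar: "\<phi> (pbar, \<chi> i. pbar) = pbar" using F_pbar \<phi> by metis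
  have inv: "inv_into P \<phi> pbar = (pbar, \<chi> i. pbar)"
    using inv_into_f_f[OF inj F_pbar(1)] \<phi>_pbar by simp
  have "\<phi> (x, \<chi> i. pbar) = x" if "x \<in> base" for x
    using that pbar_in_fibre by (subst \<phi>) (auto simp: product_manifold_def F_eq)
  then have base_leaf: "base_leaf base fibre \<phi> pbar = base"
    by (simp add: base_leaf_def inv)
  have "\<phi> (pbar, \<chi> j. if j = i then x else pbar) = x" if "x \<in> fibre i" for i x
  proof -
    have "(pbar, \<chi> j. if j = i then x else pbar) \<in> P"
      using that pbar_in_fibre pbar_in_base by (simp add: product_manifold_def)
    moreover have "(\<Sum>j\<in>UNIV. (if j = i then x else pbar) - pbar) = (\<Sum>j\<in>UNIV. if j = i then x - pbar else 0)"
      by (rule sum.cong) auto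
    ultimately show ?thesis by (simp add: \<phi> F_eq B_a_pbar)
  qed
  then have leaf: "leaf base fibre \<phi> i pbar = fibre i" for i
    by (simp add: leaf_def inv cong: if_cong image_cong)
  have TQ: "tangent_space (hyperquadric B \<kappa>) pbar = {w. B pbar w = 0}"
    using Q.tangent_space_eq[OF pbar_in] by simp
  have nd: "nondegenerate_on B {w. B pbar w = 0}"
    using Q.nondegenerate_tangent[OF pbar_in] by simp
  have "mean_curvature_vector B (hyperquadric B \<kappa>) (fibre i) pbar = \<kappa> *\<^sub>R pbar - a i" for i
    using fibre.mean_curvature_vector_eq[OF pbar_in_fibre \<kappa>_nonzero refl TQ nd, of i] V_nontrivial
    by (simp add: W_perp_pbar)
  then show ?thesis
    unfolding determined_by_def base_leaf leaf
    using base.tangent_space_eq[OF pbar_in_base] fibre.tangent_space_eq[OF pbar_in_fibre] F_pbar(1) \<phi>_pbar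
    by (auto simp: U0_perp_pbar W_perp_pbar intro: rev_image_eqI)
qed

end

theorem corollary12p7:
  fixes B :: "'a::euclidean_space \<Rightarrow> 'a \<Rightarrow> real"
    and \<nu> :: nat and \<kappa> :: real
    and pbar :: 'a and V0 :: "'a set" and V :: "'k::finite \<Rightarrow> 'a set" and a :: "'k \<Rightarrow> 'a"
    and N0 N0\<kappa> :: "'a set" and N :: "'k \<Rightarrow> 'a set" and \<rho> :: "'k \<Rightarrow> 'a \<Rightarrow> real"
    and \<psi> \<phi> :: "'a \<times> ('a ^ 'k) \<Rightarrow> 'a"
  assumes "pseudo_euclidean B \<nu>"
    and "\<kappa> \<noteq> 0"
    and "hyperquadric_initial_data B \<kappa> pbar V0 V a"
    and "N0 = wp_base B pbar (span (insert pbar V0)) a"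
    and "N = wp_fibre B pbar V a"
    and "\<rho> = wp_scale B pbar a"
    and "\<psi> = restrict (wp_map B pbar a) (product_manifold N0 N)"
    and "N0\<kappa> = {p \<in> N0. B p p = 1 / \<kappa>}"
    and "\<phi> = restrict \<psi> (product_manifold N0\<kappa> N)"
  shows "warped_product_decomposition (hyperquadric B \<kappa>) (induced_metric B)
           N0\<kappa> (induced_metric B) \<rho> N (\<lambda>i. induced_metric B) \<phi> \<and>
         determined_by B \<kappa> N0\<kappa> N \<phi> pbar V0 V a"
proof -
  interpret hyperquadric_splitting B \<kappa> pbar V0 V a
    using assms(1-3) by unfold_locales (auto simp: pseudo_euclidean_def)
  have N: "N = fibre" unfolding assms(5) by (rule ext) (rule wp_fibre_eq)
  have N0\<kappa>: "N0\<kappa> = base" unfolding assms(4,8) wp_base_eq by (auto simp: base_def)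
  have "product_manifold N0\<kappa> N \<subseteq> product_manifold N0 N"
    using assms(8) by (auto simp: product_manifold_def)
  then have "\<phi> x = F x" if "x \<in> P" for x
    using that unfolding assms(7,9) N N0\<kappa> by auto
  then show ?thesis
    unfolding N N0\<kappa> assms(6) wp_scale_eq
    using decomposition_of_hyperquadric determined_by_initial_data by blast
qed

end
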